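(* Let $d\ge 2$ be an integer, let $\omega$ be a $(1,d-1)$-weight vector, let $y=(\xi_1,\dots,\xi_{d-1})\in M_{1,d-1}$, and let $k\in\{1,\dots,d-1\}$. Assume there exists a $k$-element subset $\{n_1,\dots,n_k\}\subset\{1,\dots,d-1\}$ such that $1,\xi_{n_1},\dots,\xi_{n_k}$ are linearly independent over $\mathbb{Q}$. Then $\{y\}$ is not contained in any proper rational weakly constraining $(d-k)$-pencil, and $\boldsymbol{L}^{\omega}(\Lambda_y,\cdot)$ is connected at $d-k$. In particular, if $1,\xi_1,\dots,\xi_{d-1}$ are linearly independent over $\mathbb{Q}$, then $\boldsymbol{L}^{\omega}(\Lambda_y,\cdot)$ is connected at every $1\le k\le d-1$.
   Context: Let $m=1$ and $n=d-1$. $M_{m,n}$ denotes the space of real $m\times n$ matrices. Vectors of $\mathbb{R}^d$ are column vectors; $e_1,\dots,e_d$ is the standard basis. A vector $\omega=(\omega_1,\dots,\omega_d)\in\mathbb{R}^d$ is an $(m,n)$-weight vector if $\omega_1\ge\cdots\ge\omega_m>0$, $\omega_{m+1}\ge\cdots\ge\omega_d>0$ and $\sum_{i=1}^m\omega_i=\sum_{j=m+1}^d\omega_j=1$. For $t\in\mathbb{R}$ put $a^{\omega}_t=\mathrm{diag}(e^{\omega_1 t},\dots,e^{\omega_m t},e^{-\omega_{m+1}t},\dots,e^{-\omega_d t})$. For $x\in M_{m,n}$ put $u(x)=\begin{pmatrix}\mathbb{I}_m & x\\ 0&\mathbb{I}_n\end{pmatrix}$, $\Lambda_x=u(x)\mathbb{Z}^d$,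 and let $\tilde{x}=(\mathbb{I}_m\mid x)\in M_{m,d}$ be the first $m$ rows of $u(x)$, regarded as a linear map $\mathbb{R}^d\to\mathbb{R}^m\cong\langle e_1,\dots,e_m\rangle$. A unimodular lattice is a lattice in $\mathbb{R}^d$ of covolume $1$. Let $\mathcal{C}$ be the closed unit cube of $\mathbb{R}^d$ centered at $0$ (its side length is immaterial below: rescaling $\mathcal{C}$ adds the same constant to all $L_i^\omega$). For a unimodular lattice $\Lambda$, $t\ge 0$ and $1\le i\le d$, $\lambda_i(a^{\omega}_t\Lambda)$ is the least $\lambda>0$ such that $\lambda\mathcal{C}$ contains $i$ linearly independent vectors of $a^{\omega}_t\Lambda$. Set $L^{\omega}_i(\Lambda,t)=\log\lambda_i(a^{\omega}_t\Lambda)$ and $\boldsymbol{L}^{\omega}(\Lambda,t)=(L^{\omega}_1(\Lambda,t),\dots,L^{\omega}_d(\Lambda,t))$. For $l\in\{1,\dots,d-1\}$, $\boldsymbol{L}^{\omega}(\Lambda,\cdot)$ is connected at $l$ if the set $\{t\ge 0: L^{\omega}_l(\Lambda,t)=L^{\omega}_{l+1}(\Lambda,t)\}$ is unbounded above. For linear subspaces $W\subset\mathbb{R}^d$ and $W'\subset\langle e_1,\dots,e_m\rangle$ set $I(W)=\{i\in\{m+1,\dots,d\}:\dim(W\cap\langle e_1,\dots,e_i\rangle)>\dim(W\cap\langle e_1,\dots,e_{i-1}\rangle)\}$, $J(W')=\{j\in\{1,\dots,m\}:\dim(W'\cap\langle e_{j+1},\dots,e_m\rangle)<\dim(W'\cap\langle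 e_j,\dots,e_m\rangle)\}$ (with $\langle e_{j+1},\dots,e_m\rangle=0$ if $j=m$), and $\psi(W)=\sum_{i\in I(W)}\omega_i$, $\phi(W')=\sum_{j\in J(W')}\omega_j$ (empty sums are $0$). For $l\in\{1,\dots,d-1\}$, $a,b\in\mathbb{R}$ and an $l$-dimensional subspace $W\subset\mathbb{R}^d$, the $l$-pencil $\mathcal{P}^{\omega}_{W,a,b}$ is $\{x\in M_{m,n}:\psi(\ker\tilde{x}\cap W)\ge a\text{ and }\phi(\tilde{x}W)\le b\}$. It is rational if $W$ has a basis in $\mathbb{Q}^d$, weakly constraining if $b\le a$, and proper if $\mathcal{P}^{\omega}_{W,a,b}\ne M_{m,n}$. *)

theory Defs
  imports "HOL-Analysis.Analysis"
begin

(* The ambient space R^d with d = m + n is real^('m + 'n), where CARD('m) = m and CARD('n) = n.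
   'm and 'n are finite linear orders: Inl runs through the coordinates 1, ..., m and Inr through
   m+1, ..., d, in increasing order.  M_{m,n} is the type real^'n^'m. *)

definition weight_vector :: "real^('m::{finite,linorder} + 'n::{finite,linorder}) \<Rightarrow> bool" where
  "weight_vector \<omega> \<longleftrightarrow>
     (\<forall>i j. i \<le> j \<longrightarrow> \<omega> $ Inl i \<ge> \<omega> $ Inl j) \<and> (\<forall>i. \<omega> $ Inl i > 0) \<and>
     (\<forall>i j. i \<le> j \<longrightarrow> \<omega> $ Inr i \<ge> \<omega> $ Inr j) \<and> (\<forall>j. \<omega> $ Inr j > 0) \<and>
     (\<Sum>i\<in>UNIV. \<omega> $ Inl i) = 1 \<and> (\<Sum>j\<in>UNIV. \<omega> $ Inr j) = 1"

definition diag_flow :: "real^('m::finite + 'n::finite) \<Rightarrow> real \<Rightarrow> real^('m + 'n)^('m + 'n)" where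
  "diag_flow \<omega> t = (\<chi> i j. if i = j
     then (case i of Inl _ \<Rightarrow> exp (\<omega> $ i * t) | Inr _ \<Rightarrow> exp (- (\<omega> $ i) * t)) else 0)"

definition unip :: "real^'n::finite^'m::finite \<Rightarrow> real^('m + 'n)^('m + 'n)" where
  "unip x = (\<chi> i j. case (i, j) of
       (Inl a, Inr b) \<Rightarrow> x $ a $ b
     | _ \<Rightarrow> if i = j then 1 else 0)"

definition lattice_of :: "real^'n::finite^'m::finite \<Rightarrow> (real^('m + 'n)) set" where
  "lattice_of x = {unip x *v z | z. \<forall>i. z $ i \<in> \<int>}"

definition xtilde :: "real^'n::finite^'m::finite \<Rightarrow> real^('m + 'n)^'m" where
  "xtilde x = (\<chi> i. unip x $ Inl i)"

definition unit_cube :: "(real^'d::finite) set" where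
  "unit_cube = cbox (\<chi> i. -1/2) (\<chi> i. 1/2)"

definition succ_min :: "nat \<Rightarrow> (real^'d::finite) set \<Rightarrow> real" where
  "succ_min i \<Lambda> = (LEAST r. r > 0 \<and>
     (\<exists>S. S \<subseteq> \<Lambda> \<inter> (\<lambda>v. r *\<^sub>R v) ` unit_cube \<and> independent S \<and> card S = i))"

definition log_min ::
  "real^('m::finite + 'n::finite) \<Rightarrow> (real^('m + 'n)) set \<Rightarrow> nat \<Rightarrow> real \<Rightarrow> real" where
  "log_min \<omega> \<Lambda> i t = ln (succ_min i ((\<lambda>v. diag_flow \<omega> t *v v) ` \<Lambda>))"

definition connected_at ::
  "real^('m::finite + 'n::finite) \<Rightarrow> (real^('m + 'n)) set \<Rightarrow> nat \<Rightarrow> bool" where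
  "connected_at \<omega> \<Lambda> l \<longleftrightarrow> \<not> bdd_above {t. 0 \<le> t \<and> log_min \<omega> \<Lambda> l t = log_min \<omega> \<Lambda> (Suc l) t}"

(* For i = Inr j, the initial segments <e_1, ..., e_i> and <e_1, ..., e_(i-1)> contain all of
   e_1, ..., e_m. *)
definition I_set :: "(real^('m::finite + 'n::{finite,linorder})) set \<Rightarrow> 'n set" where
  "I_set W = {j.
     dim (W \<inter> span (range (\<lambda>a. axis (Inl a) 1) \<union> (\<lambda>b. axis (Inr b) 1) ` {..j})) >
     dim (W \<inter> span (range (\<lambda>a. axis (Inl a) 1) \<union> (\<lambda>b. axis (Inr b) 1) ` {..<j}))}"

definition J_set :: "(real^'m::{finite,linorder}) set \<Rightarrow> 'm set" where
  "J_set W' = {j. dim (W' \<inter> span ((\<lambda>k. axis k 1) ` {j<..})) <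
                  dim (W' \<inter> span ((\<lambda>k. axis k 1) ` {j..}))}"

definition psi :: "real^('m::finite + 'n::{finite,linorder}) \<Rightarrow> (real^('m + 'n)) set \<Rightarrow> real" where
  "psi \<omega> W = (\<Sum>j\<in>I_set W. \<omega> $ Inr j)"

definition phi :: "real^('m::{finite,linorder} + 'n::finite) \<Rightarrow> (real^'m::{finite,linorder}) set \<Rightarrow> real" where
  "phi \<omega> W' = (\<Sum>j\<in>J_set W'. \<omega> $ Inl j)"

definition pencil ::
  "real^('m::{finite,linorder} + 'n::{finite,linorder}) \<Rightarrow> (real^('m + 'n)) set \<Rightarrow> real \<Rightarrow> real
     \<Rightarrow> (real^'n::{finite,linorder}^'m::{finite,linorder}) set" where
  "pencil \<omega> W a b = {x. psi \<omega> ({v. xtilde x *v v = 0} \<inter> W) \<ge> a \<and>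
                         phi \<omega> ((\<lambda>v. xtilde x *v v) ` W) \<le> b}"

definition rational_subspace :: "(real^'d::finite) set \<Rightarrow> bool" where
  "rational_subspace W \<longleftrightarrow> (\<exists>B. (\<forall>v\<in>B. \<forall>i. v $ i \<in> \<rat>) \<and> independent B \<and> span B = W)"

definition proper_rational_weakly_constraining_pencil ::
  "real^('m::{finite,linorder} + 'n::{finite,linorder}) \<Rightarrow> nat \<Rightarrow> (real^'n::{finite,linorder}^'m::{finite,linorder}) set \<Rightarrow> bool" where
  "proper_rational_weakly_constraining_pencil \<omega> l P \<longleftrightarrow>
     (\<exists>W a b. subspace W \<and> dim W = l \<and> P = pencil \<omega> W a b \<and>
        rational_subspace W \<and> b \<le> a \<and> P \<noteq> UNIV)"

(* Linear independence over Q of the family (v i)_{i in A}; the injectivity clause excludes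
   repeated members, which independence of the image set alone would not detect. *)
definition rat_independent_family :: "('i \<Rightarrow> real) \<Rightarrow> 'i set \<Rightarrow> bool" where
  "rat_independent_family v A \<longleftrightarrow>
     inj_on v A \<and> module.independent (\<lambda>(q::rat) (r::real). of_rat q * r) (v ` A)"

(* The numbers 1, y_j (j in S) are linearly independent over Q, for a row vector y; None indexes
   the entry 1. *)
definition one_and_entries_independent :: "real^'n::finite^1 \<Rightarrow> 'n set \<Rightarrow> bool" where
  "one_and_entries_independent y S \<longleftrightarrow>
     rat_independent_family (case_option 1 (\<lambda>j. y $ 1 $ j)) (insert None (Some ` S))"

end

theory Submission
  imports Defs
begin

text \<open>
  Put \<open>l = d - k\<close>. A rational \<open>l\<close>-dimensional subspace cannot lie in the kernel of the first row of
  \<open>u(y)\<close>: over the rationals it would meet the coordinate space of \<open>1, \<xi>\<^sub>n\<^sub>1, \<dots>, \<xi>\<^sub>n\<^sub>k\<close> and produce a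
  rational relation. For the pencils this forces \<open>\<phi> = 1\<close>, hence \<open>\<psi> \<ge> 1\<close>, hence a kernel of dimension
  at least \<open>d - 1\<close> inside \<open>W\<close>.

  If the \<open>l\<close>-th and \<open>(l+1)\<close>-st minima differ for all large \<open>t\<close>, the lattice vectors realising the
  first \<open>l\<close> minima span a subspace \<open>W\<close> that is locally constant in \<open>t\<close>, hence constant. Let \<open>r\<close> be
  the \<open>l\<close>-th minimum. As \<open>W\<close> is not contained in the kernel of the first coordinate, it has a
  complement spanned by contracted coordinate vectors, and two estimates contradict each other.
  Comparing determinants bounds \<open>r\<^sup>l\<close> from below. On the other hand, take a lattice vector \<open>q\<close> outside
  \<open>W\<close>; its component along the complement is contracted exponentially, and by Dirichlet's theorem some
  bounded multiple of \<open>q\<close> has \<open>W\<close>-component within \<open>r/2\<close> of the lattice. Their difference is a lattice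
  vector outside \<open>W\<close>, so its length exceeds \<open>r\<close>, which gives \<open>r \<le> r/2 + C e\<^sup>-\<^sup>\<alpha>\<^sup>t\<close>.
\<close>

section \<open>Rational subspaces and the kernel of the first row\<close>

lemma xtilde_apply:
  fixes y :: "real^'n::finite^1"
  shows "(xtilde y *v v) $ 1 = v $ Inl 1 + (\<Sum>j\<in>UNIV. y $ 1 $ j * v $ Inr j)"
  by (simp add: xtilde_def unip_def matrix_vector_mult_def UNIV_Plus_UNIV[symmetric] sum.Plus
      del: UNIV_Plus_UNIV)

lemma rat_independent_familyD:
  assumes "rat_independent_family v A" "finite A" "(\<Sum>i\<in>A. of_rat (c i) * v i) = 0" "i \<in> A"
  shows "c i = 0"
proof -
  interpret Q: vector_space "\<lambda>(q::rat) (r::real). of_rat q * r"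
    by unfold_locales (auto simp: algebra_simps of_rat_add of_rat_mult)
  have inj: "inj_on v A" and ind: "Q.independent (v ` A)"
    using assms(1) by (auto simp: rat_independent_family_def)
  have "(\<Sum>x\<in>v ` A. of_rat (c (the_inv_into A v x)) * x) = 0"
    using assms(3) by (simp add: sum.reindex[OF inj] the_inv_into_f_f[OF inj])
  then have "\<forall>x\<in>v ` A. c (the_inv_into A v x) = 0"
    using ind unfolding Q.dependent_finite[OF finite_imageI[OF assms(2)]]
    by (auto dest!: spec[of _ "\<lambda>x. c (the_inv_into A v x)"])
  then have "c (the_inv_into A v (v i)) = 0"
    using assms(4) by simp
  then show ?thesis
    by (simp add: the_inv_into_f_f[OF inj] assms(4))
qed

lemma one_and_entries_independentD:
  fixes y :: "real^'n::finite^1" and a :: rat and c :: "'n \<Rightarrow> rat"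
  assumes "one_and_entries_independent y S" "of_rat a + (\<Sum>j\<in>S. of_rat (c j) * y $ 1 $ j) = 0"
  shows "a = 0" "\<And>j. j \<in> S \<Longrightarrow> c j = 0"
proof -
  let ?c = "case_option a c"
  have "(\<Sum>i\<in>insert None (Some ` S). of_rat (?c i) * (case i of None \<Rightarrow> 1 | Some j \<Rightarrow> y $ 1 $ j)) = 0"
    using assms(2) by (simp add: sum.reindex)
  from rat_independent_familyD[OF assms(1)[unfolded one_and_entries_independent_def] _ this]
  have *: "\<And>i. i \<in> insert None (Some ` S) \<Longrightarrow> ?c i = 0"
    by simp
  show "a = 0" using *[of None] by simp
  show "c j = 0" if "j \<in> S" for j using *[of "Some j"] that by simp
qed

lemma vec_independent_of_rat_image:
  fixes r :: "real^'d::finite \<Rightarrow> rat^'d"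
  assumes "independent B" and r: "\<And>v i. v \<in> B \<Longrightarrow> of_rat (r v $ i) = v $ i"
  shows "inj_on r B" "vec.independent (r ` B)"
proof -
  show inj: "inj_on r B"
  proof (rule inj_onI)
    fix v w assume "v \<in> B" "w \<in> B" "r v = r w"
    then have "v $ i = w $ i" for i
      using r[of v i] r[of w i] by simp
    then show "v = w"
      by (simp add: vec_eq_iff)
  qed
  have fin: "finite B" using assms(1) by (rule independent_imp_finite)
  show "vec.independent (r ` B)"
  proof (rule vec.independent_if_scalars_zero[OF finite_imageI[OF fin]])
    fix c w assume "(\<Sum>x\<in>r ` B. c x *s x) = 0" and "w \<in> r ` B"
    then obtain v where 0: "(\<Sum>x\<in>B. c (r x) *s r x) = 0" and v: "v \<in> B" "w = r v"
      by (auto simp: sum.reindex[OF inj])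
    have "(\<Sum>x\<in>B. of_rat (c (r x)) *\<^sub>R x) = 0"
      unfolding vec_eq_iff
    proof
      fix i
      have "of_rat ((\<Sum>x\<in>B. c (r x) *s r x) $ i) = (0::real)"
        by (simp add: 0)
      then show "(\<Sum>x\<in>B. of_rat (c (r x)) *\<^sub>R x) $ i = (0::real^'d) $ i"
        by (simp add: of_rat_sum of_rat_mult r)
    qed
    then show "c w = 0"
      using assms(1) v unfolding dependent_finite[OF fin]
      by (auto dest!: spec[of _ "\<lambda>x. of_rat (c (r x))"])
  qed
qed

lemma card_rational_kernel_le:
  fixes y :: "real^'n::finite^1" and B :: "(real^(1 + 'n)) set"
  assumes y: "one_and_entries_independent y S" and B: "independent B"
    and rat: "\<And>v i. v \<in> B \<Longrightarrow> v $ i \<in> \<rat>" and ker: "\<And>v. v \<in> B \<Longrightarrow> xtilde y *v v = 0"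
  shows "card B + card S \<le> CARD('n)"
proof (rule ccontr)
  assume gt: "\<not> ?thesis"
  define r :: "real^(1 + 'n) \<Rightarrow> rat^(1 + 'n)" where "r v = (\<chi> i. SOME q. of_rat q = v $ i)" for v
  have r: "of_rat (r v $ i) = v $ i" if "v \<in> B" for v i
  proof -
    have "\<exists>q. of_rat q = v $ i"
      using rat[OF that, of i] unfolding Rats_def by (metis imageE)
    then show ?thesis
      unfolding r_def vec_lambda_beta by (rule someI_ex)
  qed
  note ri = vec_independent_of_rat_image[OF B r, simplified]
  define E :: "(rat^(1 + 'n)) set" where "E = (\<lambda>i. axis i 1) ` insert (Inl 1) (Inr ` S)"
  have "vec.independent E"
    by (rule vec.independent_mono[OF independent_cart_basis]) (auto simp: E_def cart_basis_def)
  moreover have "card E = card S + 1"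
    unfolding E_def by (subst card_image) (auto simp: inj_on_def axis_eq_axis card_image card_insert_if)
  moreover have "card (r ` B) = card B"
    using ri by (simp add: card_image)
  moreover note vec.dim_sums_Int[OF vec.subspace_span[of "r ` B"] vec.subspace_span[of E]]
  moreover have "vec.dim {x + y |x y. x \<in> vec.span (r ` B) \<and> y \<in> vec.span E} \<le> CARD(1 + 'n)"
    by (rule dim_subset_UNIV_cart_gen)
  ultimately have "vec.dim (vec.span (r ` B) \<inter> vec.span E) \<noteq> 0"
    using gt ri(2) by (simp add: vec.dim_eq_card_independent del: vec.dim_eq_0)
  then have "\<not> vec.span (r ` B) \<inter> vec.span E \<subseteq> {0}"
    by simp
  then obtain v where v: "v \<in> vec.span (r ` B)" "v \<in> vec.span E" "v \<noteq> 0"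
    by auto
  define f :: "rat^(1 + 'n) \<Rightarrow> real"
    where "f v = of_rat (v $ Inl 1) + (\<Sum>j\<in>UNIV. of_rat (v $ Inr j) * y $ 1 $ j)" for v
  have f_add: "f (v + w) = f v + f w" for v w
    by (simp add: f_def of_rat_add algebra_simps sum.distrib)
  have f_scale: "f (c *s v) = of_rat c * f v" for c v
    by (simp add: f_def of_rat_mult algebra_simps sum_distrib_left)
  have fv: "f v = 0"
    using v(1)
  proof (induction rule: vec.span_induct)
    case base
    have "f 0 = 0" by (simp add: f_def)
    then show ?case
      by (simp add: vec.subspace_def f_add f_scale)
  next
    case (step w)
    then obtain b where b: "b \<in> B" "w = r b" by auto
    then show ?case using ker[OF b(1)] xtilde_apply[of y b] 
      by (simp add: r mult.commute f_def)
  qed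
  have supp: "\<forall>j. j \<notin> S \<longrightarrow> v $ Inr j = 0"
    using v(2)
    by (induction rule: vec.span_induct) (auto simp: E_def axis_def vec.subspace_def)
  then have "(\<Sum>j\<in>UNIV. of_rat (v $ Inr j) * y $ 1 $ j) = (\<Sum>j\<in>S. of_rat (v $ Inr j) * y $ 1 $ j)"
    by (intro sum.mono_neutral_right) auto
  then have "of_rat (v $ Inl 1) + (\<Sum>j\<in>S. of_rat (v $ Inr j) * y $ 1 $ j) = 0"
    using fv unfolding f_def by (metis (no_types))
  from one_and_entries_independentD[OF y this]
  have v0: "v $ Inl 1 = 0" "\<And>j. j \<in> S \<Longrightarrow> v $ Inr j = 0"
    by blast+
  have "v $ i = 0" for i
  proof (cases i)
    case (Inl a)
    moreover have "a = 1" by (rule num1_eq1)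
    ultimately show ?thesis using v0 by simp
  next
    case (Inr j)
    then show ?thesis using supp v0 by (cases "j \<in> S") auto
  qed
  then show False
    using v(3) by (simp add: vec_eq_iff)
qed

section \<open>Pencils\<close>

lemma J_set_eq_UNIV_num1:
  fixes W :: "(real^1) set"
  assumes "w \<in> W" "w \<noteq> 0" 
  shows "J_set W = UNIV"
proof -
  have "j \<in> J_set W" for j :: 1
  proof -
    have j: "j = 1" by (rule num1_eq1)
    have "span {axis (1::1) (1::real)} = UNIV"
      using span_Basis[where 'a="real^1"] by (simp add: Basis_vec_def num1_eq1 UNIV_1)
    moreover have "{j<..} = {}" "{j..} = {1}"
      unfolding j by (auto simp: order.strict_iff_order num1_eq1)
    moreover have "dim W \<noteq> 0"
      using assms by (auto simp: dim_eq_0)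
    moreover have "dim (W \<inter> {0}) = 0"
      by auto
    ultimately show ?thesis
      by (simp add: J_set_def del: dim_eq_0)
  qed
  then show ?thesis by auto
qed

lemma card_le_dim_if_I_set_eq_UNIV:
  fixes U :: "(real^('m::finite + 'n::{finite,linorder})) set"
  assumes "subspace U" "I_set U = UNIV"
  shows "CARD('n) \<le> dim U"
proof -
  let ?L = "range (\<lambda>a. axis (Inl a) 1) :: (real^('m + 'n)) set"
  let ?F = "\<lambda>A. span (?L \<union> (\<lambda>b. axis (Inr b) 1) ` A)"
  define p :: "real^('m::finite + 'n::{finite,linorder}) \<Rightarrow> real^'n::{finite,linorder}" where "p v = (\<chi> j. v $ Inr j)" for v
  have "linear p"
    by (rule linearI) (simp_all add: p_def vec_eq_iff)
  have "\<exists>u\<in>U. u $ Inr j \<noteq> 0 \<and> (\<forall>i>j. u $ Inr i = 0)" for j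
  proof -
    have "j \<in> I_set U" using assms(2) by simp
    then have "dim (U \<inter> ?F {..<j}) < dim (U \<inter> ?F {..j})"
      by (simp add: I_set_def)
    then have "\<not> U \<inter> ?F {..j} \<subseteq> U \<inter> ?F {..<j}"
      using dim_subset by (metis not_le)
    then obtain u where u: "u \<in> U" "u \<in> ?F {..j}" "u \<notin> ?F {..<j}" 
      by auto
    have sup: "u $ Inr i = 0" if "i > j" for i
      using u(2) 
    proof (induction rule: span_induct)
      case base
      show ?case by (auto simp: subspace_def)
    qed (use that in \<open>auto simp: axis_def\<close>)
    moreover have "u $ Inr j \<noteq> 0"
    proof
      assume j0: "u $ Inr j = 0"
      have "u = (\<Sum>i\<in>UNIV. u $ i *\<^sub>R axis i 1)"
        using basis_expansion[of u] by (simp add: scalar_mult_eq_scaleR)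
      also have "\<dots> \<in> ?F {..<j}"
      proof (rule span_sum)
        fix i
        show "u $ i *\<^sub>R axis i 1 \<in> ?F {..<j}"
        proof (cases i)
          case (Inl a)
          then show ?thesis by (intro span_scale span_base) auto
        next
          case (Inr b)
          then show ?thesis using j0 sup[of b]
            by (cases b j rule: linorder_cases) (auto simp: span_zero intro!: span_scale[OF span_base])
        qed
      qed
      finally show False using u(3) by simp
    qed
    ultimately show ?thesis using u(1) by auto
  qed
  then obtain u where u: "\<And>j. u j \<in> U" "\<And>j. u j $ Inr j \<noteq> 0" "\<And>i j. j < i \<Longrightarrow> u j $ Inr i = 0"
    by metis
  have "span (p ` U) = UNIV"
  proof (rule ccontr)
    assume "span (p ` U) \<noteq> UNIV"
    then obtain x where x: "x \<noteq> 0" "\<And>v. v \<in> span (p ` U) \<Longrightarrow> orthogonal x v"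
      using orthogonal_to_subspace_exists_gen[of "p ` U" UNIV] by (auto simp: psubset_eq)
    then obtain i where "x $ i \<noteq> 0" 
      by (auto simp: vec_eq_iff)
    define j where "j = Min {i. x $ i \<noteq> 0}"
    have j: "x $ j \<noteq> 0" "\<And>i. x $ i \<noteq> 0 \<Longrightarrow> j \<le> i"
      using Min_in[of "{i. x $ i \<noteq> 0}"] \<open>x $ i \<noteq> 0\<close> unfolding j_def by auto
    have "0 = x \<bullet> p (u j)"
      using x(2)[of "p (u j)"] u(1) by (simp add: orthogonal_def span_base)
    also have "\<dots> = (\<Sum>i\<in>UNIV. if i = j then x $ j * u j $ Inr j else 0)"
      unfolding inner_vec_def using j(2) u(3)
      by (intro sum.cong) (auto simp: p_def, metis less_le)
    finally show False using j(1) u(2) by simp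
  qed
  then have "CARD('n) = dim (p ` U)"
    by (metis dim_span dim_UNIV DIM_cart DIM_real mult.right_neutral)
  also have "\<dots> \<le> dim U"
    using \<open>linear p\<close> by (rule dim_image_le)
  finally show ?thesis .
qed

lemma rational_subspace_not_subset_kernel:
  fixes y :: "real^'n::finite^1"
  assumes "one_and_entries_independent y S" "rational_subspace W" "dim W + card S > CARD('n)"
  shows "\<exists>v\<in>W. xtilde y *v v \<noteq> 0"
proof (rule ccontr)
  assume *: "\<not> ?thesis"
  obtain B where B: "\<And>v i. v \<in> B \<Longrightarrow> v $ i \<in> \<rat>" "independent B" "span B = W"
    using assms(2) unfolding rational_subspace_def by metis
  have "card B + card S \<le> CARD('n)"
    using * B span_base by (intro card_rational_kernel_le[OF assms(1)]) blast+
  moreover have "card B = dim W"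
    using B by (metis dim_span_eq_card_independent)
  ultimately show False using assms(3) by simp
qed

lemma not_in_weakly_constraining_pencil:
  fixes \<omega> :: "real^(1 + 'n::{finite,linorder})" and y :: "real^'n::{finite,linorder}^1"
  assumes \<omega>: "weight_vector \<omega>" and y: "one_and_entries_independent y S"
    and W: "subspace W" "rational_subspace W" "CARD('n) < dim W + card S" "dim W \<le> CARD('n)"
    and "b \<le> a"
  shows "y \<notin> pencil \<omega> W a b"
proof
  assume P: "y \<in> pencil \<omega> W a b"
  let ?K = "{v. xtilde y *v v = 0}"
  obtain v where v: "v \<in> W" "xtilde y *v v \<noteq> 0"
    using rational_subspace_not_subset_kernel[OF y W(2,3)] by auto
  have "phi \<omega> ((\<lambda>v. xtilde y *v v) ` W) = 1"
    using J_set_eq_UNIV_num1[of "xtilde y *v v", OF _ v(2), of "(\<lambda>v. xtilde y *v v) ` W"] v(1) \<omega>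
    by (simp add: phi_def weight_vector_def)
  then have "1 \<le> psi \<omega> (?K \<inter> W)"
    using P \<open>b \<le> a\<close> by (simp add: pencil_def)
  have "I_set (?K \<inter> W) = UNIV"
  proof (rule ccontr)
    assume "I_set (?K \<inter> W) \<noteq> UNIV"
    then obtain j where "j \<notin> I_set (?K \<inter> W)" by auto
    then have "psi \<omega> (?K \<inter> W) < (\<Sum>j\<in>UNIV. \<omega> $ Inr j)"
      unfolding psi_def using \<omega>
      by (intro sum_strict_mono2[of _ _ j]) (auto simp: weight_vector_def less_imp_le)
    then show False
      using \<open>1 \<le> psi \<omega> (?K \<inter> W)\<close> \<omega> by (simp add: weight_vector_def)
  qed
  moreover have K: "subspace (?K \<inter> W)"
    using W(1) by (intro subspace_inter) (auto simp: subspace_def matrix_vector_right_distrib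
        matrix_vector_mult_scaleR)
  ultimately have "CARD('n) \<le> dim (?K \<inter> W)"
    by (intro card_le_dim_if_I_set_eq_UNIV)
  moreover have "dim (?K \<inter> W) < dim W"
    using v K W(1) by (intro dim_psubset) (auto simp: span_eq_iff[THEN iffD2])
  ultimately show False
    using W(4) by simp
qed

section \<open>Successive minima\<close>

lemma infnorm_le_iff_cart: "infnorm (x::real^'d::finite) \<le> c \<longleftrightarrow> (\<forall>i. \<bar>x $ i\<bar> \<le> c)"
proof
  assume "\<forall>i. \<bar>x $ i\<bar> \<le> c"
  then show "infnorm x \<le> c"
    unfolding infnorm_cart by (intro cSup_least) auto
next
  assume "infnorm x \<le> c"
  then show "\<forall>i. \<bar>x $ i\<bar> \<le> c"
    using component_le_infnorm_cart[of x] order_trans by blast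
qed

lemma infnorm_sum_le: "infnorm (sum f A) \<le> (\<Sum>i\<in>A. infnorm (f i))"
proof (induction A rule: infinite_finite_induct)
  case (insert a A)
  then show ?case
    using infnorm_triangle[of "f a" "sum f A"] by simp
qed (simp_all add: infnorm_0)

lemma finite_integer_points_bounded:
  fixes B :: "(real^'d::finite) set"
  assumes "bounded B"
  shows "finite {z \<in> B. \<forall>i. z $ i \<in> \<int>}"
proof -
  obtain b where b: "\<And>z. z \<in> B \<Longrightarrow> norm z \<le> b"
    using assms by (auto simp: bounded_iff)
  have "vec_nth ` {z \<in> B. \<forall>i. z $ i \<in> \<int>} \<subseteq> (\<Pi>\<^sub>E i\<in>UNIV. {k \<in> \<int>. \<bar>k\<bar> \<le> b})"
    using b component_le_norm_cart order_trans by (fastforce simp: PiE_UNIV_domain)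
  then have "finite (vec_nth ` {z \<in> B. \<forall>i. z $ i \<in> \<int>})"
    by (rule finite_subset) (intro finite_PiE finite_abs_int_segment; simp)
  then show ?thesis
    by (rule finite_imageD) (simp add: inj_on_def vec_nth_inject)
qed

lemma mem_scaled_unit_cube_iff:
  fixes v :: "real^'d::finite"
  assumes "r > 0"
  shows "v \<in> (\<lambda>v. r *\<^sub>R v) ` unit_cube \<longleftrightarrow> 2 * infnorm v \<le> r"
proof -
  have "v \<in> (\<lambda>v. r *\<^sub>R v) ` unit_cube \<longleftrightarrow> (1 / r) *\<^sub>R v \<in> unit_cube"
    using assms by (auto simp: image_iff intro: bexI[of _ "(1 / r) *\<^sub>R v"])
  also have "\<dots> \<longleftrightarrow> (\<forall>i. \<bar>v $ i\<bar> \<le> r / 2)"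
  proof -
    have "- (1/2) \<le> x / r \<and> x / r \<le> 1/2 \<longleftrightarrow> \<bar>x\<bar> \<le> r / 2" for x
      using assms by (auto simp: abs_le_iff field_simps)
    then show ?thesis
      unfolding unit_cube_def mem_box_cart by simp
  qed
  also have "\<dots> \<longleftrightarrow> 2 * infnorm v \<le> r"
    unfolding infnorm_le_iff_cart[symmetric] by auto
  finally show ?thesis .
qed

lemma succ_min_least:
  fixes \<Lambda> :: "(real^'d::finite) set"
  assumes fin: "\<And>r. finite {v \<in> \<Lambda>. infnorm v \<le> r}" and "i > 0"
    and S: "S \<subseteq> \<Lambda>" "independent S" "card S = i"
  shows "\<exists>S\<subseteq>\<Lambda>. independent S \<and> card S = i \<and> (\<forall>v\<in>S. 2 * infnorm v \<le> succ_min i \<Lambda>)"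
    and "(\<And>v. v \<in> S \<Longrightarrow> 2 * infnorm v \<le> r) \<Longrightarrow> succ_min i \<Lambda> \<le> r"
proof -
  define P where "P r S \<longleftrightarrow> S \<subseteq> \<Lambda> \<and> independent S \<and> card S = i \<and> (\<forall>v\<in>S. 2 * infnorm v \<le> r)" for r S
  have pos: "r > 0" if "P r S" for r S
  proof -
    have "S \<noteq> {}" using that \<open>i > 0\<close> by (auto simp: P_def)
    then obtain v where "v \<in> S" by auto
    moreover have "v \<noteq> 0" using that \<open>v \<in> S\<close> dependent_zero by (auto simp: P_def)
    ultimately show ?thesis
      using that infnorm_pos_lt[of v] by (force simp: P_def)
  qed
  have eq: "succ_min i \<Lambda> = (LEAST r. \<exists>S. P r S)"
    unfolding succ_min_def
  proof (rule arg_cong[of _ _ Least], rule ext)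
    fix r :: real
    show "(r > 0 \<and> (\<exists>S. S \<subseteq> \<Lambda> \<inter> (\<lambda>v. r *\<^sub>R v) ` unit_cube \<and> independent S \<and> card S = i)) = (\<exists>S. P r S)"
    proof (cases "r > 0")
      case True
      have "S \<subseteq> \<Lambda> \<inter> (\<lambda>v. r *\<^sub>R v) ` unit_cube \<and> independent S \<and> card S = i \<longleftrightarrow> P r S" for S
        unfolding P_def subset_iff Int_iff mem_scaled_unit_cube_iff[OF True] by auto
      then show ?thesis using True by simp
    qed (use pos in auto)
  qed
  define N :: "(real^'d) set \<Rightarrow> real" where "N T = Max ((\<lambda>v. 2 * infnorm v) ` T)" for T
  have N: "P (N T) T" "N T \<le> r" if "P r T" for r T
  proof -
    have "finite T" "T \<noteq> {}" using that \<open>i > 0\<close> by (auto simp: P_def card_gt_0_iff)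
    then show "P (N T) T" "N T \<le> r" using that by (auto simp: P_def N_def)
  qed
  have "finite S" "S \<noteq> {}" using S \<open>i > 0\<close> by (auto simp: card_gt_0_iff)
  then have PS: "P (N S) S" using S by (simp add: P_def N_def)
  let ?V = "N ` {T. P (N S) T}"
  have "{T. P (N S) T} \<subseteq> Pow {v \<in> \<Lambda>. infnorm v \<le> N S / 2}"
    by (auto simp: P_def)
  then have "finite ?V"
    using fin by (meson finite_Pow_iff finite_imageI finite_subset)
  have "?V \<noteq> {}" using PS by auto
  then obtain T where T: "P (N S) T" "N T = Min ?V"
    using Min_in[OF \<open>finite ?V\<close>] by (metis (no_types, lifting) imageE mem_Collect_eq)
  have le: "N T \<le> r" if "P r U" for r U
  proof (cases "r \<le> N S")
    case True
    then have "P (N S) U" using that by (force simp: P_def)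
    then have "N T \<le> N U" using T(2) \<open>finite ?V\<close> by auto
    then show ?thesis using N(2)[OF that] by simp
  next
    case False
    then show ?thesis using N(2)[OF T(1)] by simp
  qed
  have least: "succ_min i \<Lambda> = N T"
    unfolding eq using N(1)[OF T(1)] le by (intro Least_equality) auto
  show "\<exists>S\<subseteq>\<Lambda>. independent S \<and> card S = i \<and> (\<forall>v\<in>S. 2 * infnorm v \<le> succ_min i \<Lambda>)"
    using N(1)[OF T(1)] unfolding least P_def by blast
  show "succ_min i \<Lambda> \<le> r" if "\<And>v. v \<in> S \<Longrightarrow> 2 * infnorm v \<le> r"
    unfolding least using that S by (intro le[of _ S]) (auto simp: P_def)
qed

lemma succ_min_mono_Suc:
  fixes \<Lambda> :: "(real^'d::finite) set"
  assumes fin: "\<And>r. finite {v \<in> \<Lambda>. infnorm v \<le> r}" and "i > 0"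
    and S: "S \<subseteq> \<Lambda>" "independent S" "card S = Suc i"
  shows "succ_min i \<Lambda> \<le> succ_min (Suc i) \<Lambda>"
proof -
  obtain T where T: "T \<subseteq> \<Lambda>" "independent T" "card T = Suc i" "\<forall>v\<in>T. 2 * infnorm v \<le> succ_min (Suc i) \<Lambda>"
    using succ_min_least(1)[OF fin _ S] by auto
  then obtain U where U: "U \<subseteq> T" "card U = i"
    using obtain_subset_with_card_n[of i T] by (metis le_SucI order_refl)
  show ?thesis
    using T U independent_mono[OF T(2) U(1)]
    by (intro succ_min_least(2)[OF fin \<open>i > 0\<close>, of U]) auto
qed

section \<open>The flow and the lattice\<close>

lemma weight_vector_le_1:
  assumes "weight_vector \<omega>"
  shows "\<omega> $ i \<le> 1"
proof (cases i)
  case (Inl a)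
  have "\<omega> $ Inl a \<le> (\<Sum>a\<in>UNIV. \<omega> $ Inl a)"
    using assms by (intro member_le_sum) (auto simp: weight_vector_def less_imp_le)
  with Inl assms show ?thesis by (simp add: weight_vector_def)
next
  case (Inr b)
  have "\<omega> $ Inr b \<le> (\<Sum>b\<in>UNIV. \<omega> $ Inr b)"
    using assms by (intro member_le_sum) (auto simp: weight_vector_def less_imp_le)
  with Inr assms show ?thesis by (simp add: weight_vector_def)
qed

lemma weight_vector_pos: "weight_vector \<omega> \<Longrightarrow> 0 < \<omega> $ i"
  by (cases i) (auto simp: weight_vector_def)

lemma diag_flow_apply:
  "(diag_flow \<omega> t *v v) $ i =
     (case i of Inl _ \<Rightarrow> exp (\<omega> $ i * t) | Inr _ \<Rightarrow> exp (- (\<omega> $ i) * t)) * v $ i"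
proof -
  have "(diag_flow \<omega> t *v v) $ i = (\<Sum>j\<in>UNIV. if j = i then
      (case i of Inl _ \<Rightarrow> exp (\<omega> $ i * t) | Inr _ \<Rightarrow> exp (- (\<omega> $ i) * t)) * v $ i else 0)"
    unfolding diag_flow_def matrix_vector_mult_def vec_lambda_beta
    by (intro sum.cong) auto
  then show ?thesis by simp
qed

lemma diag_flow_inverse: "diag_flow \<omega> (- t) *v (diag_flow \<omega> t *v v) = v"
  by (simp add: vec_eq_iff diag_flow_apply mult.assoc[symmetric] exp_add[symmetric] split: sum.split)

lemma infnorm_diag_flow_le:
  assumes \<omega>: "weight_vector \<omega>"
  shows "infnorm (diag_flow \<omega> s *v v) \<le> exp \<bar>s - t\<bar> * infnorm (diag_flow \<omega> t *v v)"
  unfolding infnorm_le_iff_cart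
proof
  fix i
  let ?c = "\<lambda>t. case i of Inl _ \<Rightarrow> exp (\<omega> $ i * t) | Inr _ \<Rightarrow> exp (- (\<omega> $ i) * t)"
  have "\<omega> $ i * \<bar>s - t\<bar> \<le> \<bar>s - t\<bar>"
    using weight_vector_le_1[OF \<omega>, of i] by (simp add: mult_left_le_one_le weight_vector_pos[OF \<omega>] less_imp_le)
  moreover have "\<bar>\<omega> $ i * s - \<omega> $ i * t\<bar> = \<omega> $ i * \<bar>s - t\<bar>"
    using weight_vector_pos[OF \<omega>, of i] by (simp add: right_diff_distrib[symmetric] abs_mult)
  ultimately have "?c s \<le> exp \<bar>s - t\<bar> * ?c t"
    by (auto simp: exp_add[symmetric] split: sum.split)
  then have "?c s * \<bar>v $ i\<bar> \<le> exp \<bar>s - t\<bar> * ?c t * \<bar>v $ i\<bar>"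
    by (rule mult_right_mono) simp
  also have "\<dots> = exp \<bar>s - t\<bar> * \<bar>(diag_flow \<omega> t *v v) $ i\<bar>"
    by (auto simp: diag_flow_apply abs_mult split: sum.split)
  also have "\<dots> \<le> exp \<bar>s - t\<bar> * infnorm (diag_flow \<omega> t *v v)"
    by (intro mult_left_mono component_le_infnorm_cart) simp
  finally show "\<bar>(diag_flow \<omega> s *v v) $ i\<bar> \<le> exp \<bar>s - t\<bar> * infnorm (diag_flow \<omega> t *v v)"
    by (auto simp: diag_flow_apply abs_mult split: sum.splits)
qed

lemma det_diag_flow:
  assumes \<omega>: "weight_vector \<omega>"
  shows "det (diag_flow \<omega> t) = 1"
proof -
  have "det (diag_flow \<omega> t) = (\<Prod>i\<in>UNIV. diag_flow \<omega> t $ i $ i)"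
    by (rule det_diagonal) (simp add: diag_flow_def)
  also have "\<dots> = (\<Prod>a\<in>UNIV. exp (\<omega> $ Inl a * t)) * (\<Prod>b\<in>UNIV. exp (- (\<omega> $ Inr b) * t))"
    by (simp add: diag_flow_def UNIV_Plus_UNIV[symmetric] prod.Plus del: UNIV_Plus_UNIV)
  also have "\<dots> = exp ((\<Sum>a\<in>UNIV. \<omega> $ Inl a) * t) * exp (- ((\<Sum>b\<in>UNIV. \<omega> $ Inr b) * t))"
    by (simp add: exp_sum[symmetric] sum_distrib_right sum_negf)
  also have "\<dots> = 1"
    using \<omega> by (simp add: weight_vector_def exp_minus)
  finally show ?thesis .
qed

lemma unip_apply_Inr: "(unip x *v z) $ Inr j = z $ Inr j"
  by (simp add: unip_def matrix_vector_mult_def UNIV_Plus_UNIV[symmetric] sum.Plus mult_delta_left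
      del: UNIV_Plus_UNIV)

lemma unip_apply_Inl: "(unip x *v z) $ Inl a = z $ Inl a + (\<Sum>b\<in>UNIV. x $ a $ b * z $ Inr b)"
  by (simp add: unip_def matrix_vector_mult_def UNIV_Plus_UNIV[symmetric] sum.Plus mult_delta_left
      del: UNIV_Plus_UNIV)

lemma unip_inverse: "unip (- x) *v (unip x *v z) = z"
  unfolding vec_eq_iff
proof
  fix i
  show "(unip (- x) *v (unip x *v z)) $ i = z $ i"
    by (cases i) (auto simp: unip_apply_Inl unip_apply_Inr sum_negf)
qed

lemma det_unip_nonzero: "det (unip x) \<noteq> 0"
proof -
  have "z = 0" if "unip x *v z = 0" for z
    using unip_inverse[of x z] that by simp
  then show ?thesis
    by (simp add: invertible_det_nz[symmetric] invertible_left_inverse matrix_left_invertible_ker)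
qed

lemma lattice_of_0: "0 \<in> lattice_of x"
  unfolding lattice_of_def by (auto intro!: exI[of _ 0])

lemma lattice_of_diff:
  assumes "v \<in> lattice_of x" "w \<in> lattice_of x"
  shows "v - w \<in> lattice_of x"
proof -
  obtain z z' where "v = unip x *v z" "\<forall>i. z $ i \<in> \<int>" "w = unip x *v z'" "\<forall>i. z' $ i \<in> \<int>"
    using assms by (auto simp: lattice_of_def)
  then show ?thesis
    unfolding lattice_of_def by (auto intro!: exI[of _ "z - z'"] simp: matrix_vector_mult_diff_distrib)
qed

lemma lattice_of_scale:
  assumes "v \<in> lattice_of x"
  shows "of_int k *\<^sub>R v \<in> lattice_of x"
proof -
  obtain z where "v = unip x *v z" "\<forall>i. z $ i \<in> \<int>"
    using assms by (auto simp: lattice_of_def)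
  then show ?thesis
    unfolding lattice_of_def by (auto intro!: exI[of _ "of_int k *\<^sub>R z"] simp: matrix_vector_mult_scaleR)
qed

lemma lattice_of_sum:
  assumes "\<And>i. i \<in> A \<Longrightarrow> f i \<in> lattice_of x"
  shows "sum f A \<in> lattice_of x"
  using assms
proof (induction A rule: infinite_finite_induct)
  case (insert a A)
  have "f a - (0 - sum f A) \<in> lattice_of x"
    by (intro lattice_of_diff lattice_of_0 insert) (use insert in auto)
  then show ?case using insert by simp
qed (auto simp: lattice_of_0)

lemma finite_diag_flow_lattice_bounded:
  "finite {v \<in> (\<lambda>v. diag_flow \<omega> t *v v) ` lattice_of x. infnorm v \<le> r}"
proof -
  define A where "A = diag_flow \<omega> (- t)"
  define U where "U = unip (- x)"
  have "bounded {v :: real^('a + 'b). infnorm v \<le> r}"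
  proof (rule boundedI)
    fix v :: "real^('a + 'b)" assume "v \<in> {v. infnorm v \<le> r}"
    then have "sqrt DIM(real^('a + 'b)) * infnorm v \<le> sqrt DIM(real^('a + 'b)) * r"
      by (intro mult_left_mono) auto
    with norm_le_infnorm[of v] show "norm v \<le> sqrt DIM(real^('a + 'b)) * r"
      by linarith
  qed
  then have "bounded ((\<lambda>v. U *v (A *v v)) ` {v. infnorm v \<le> r})"
    by (rule bounded_linear_image)
      (rule bounded_linear_compose[OF matrix_vector_mul_bounded_linear matrix_vector_mul_bounded_linear])
  then have fin: "finite {z \<in> (\<lambda>v. U *v (A *v v)) ` {v. infnorm v \<le> r}. \<forall>i. z $ i \<in> \<int>}" (is "finite ?Z")
    by (rule finite_integer_points_bounded)
  have "{v \<in> (\<lambda>v. diag_flow \<omega> t *v v) ` lattice_of x. infnorm v \<le> r} \<subseteq> (\<lambda>z. diag_flow \<omega> t *v (unip x *v z)) ` ?Z"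
  proof
    fix v assume "v \<in> {v \<in> (\<lambda>v. diag_flow \<omega> t *v v) ` lattice_of x. infnorm v \<le> r}"
    then obtain z where z: "v = diag_flow \<omega> t *v (unip x *v z)" "\<forall>i. z $ i \<in> \<int>" "infnorm v \<le> r"
      by (auto simp: lattice_of_def)
    then have "z = U *v (A *v v)"
      by (simp add: A_def U_def diag_flow_inverse unip_inverse)
    with z show "v \<in> (\<lambda>z. diag_flow \<omega> t *v (unip x *v z)) ` ?Z"
      by blast
  qed
  then show ?thesis
    by (rule finite_subset) (intro finite_imageI fin)
qed

lemma lattice_of_contains_basis:
  fixes x :: "real^'n::finite^'m::finite"
  shows "\<exists>S\<subseteq>lattice_of x. independent S \<and> card S = CARD('m + 'n)"
proof -
  have inj: "inj ((*v) (unip x))"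
    by (metis injI unip_inverse)
  let ?S = "(*v) (unip x) ` Basis"
  have "?S \<subseteq> lattice_of x"
    by (auto simp: lattice_of_def Basis_vec_def axis_def)
  moreover have "independent ?S"
    using inj by (intro linear_independent_injective_image independent_Basis) (auto intro: inj_on_subset)
  moreover have "card ?S = CARD('m + 'n)"
    using card_image[OF inj_on_subset[OF inj, of Basis]] by simp
  ultimately show ?thesis by blast
qed

section \<open>The subspace spanned by the first minima\<close>

text \<open>
  \<open>r\<close> and \<open>\<rho>\<close> separate the \<open>l\<close>-th from the \<open>(l+1)\<close>-st minimum at time \<open>t\<close>. Leaving them free, instead
  of fixing them to be the minima, makes the condition visibly open in \<open>t\<close>.
\<close>
definition gap_space ::
  "real^('m::finite + 'n::finite) \<Rightarrow> (real^('m + 'n)) set \<Rightarrow> nat \<Rightarrow> real \<Rightarrow> (real^('m + 'n)) set \<Rightarrow> bool" where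
  "gap_space \<omega> \<Lambda> l t W \<longleftrightarrow> (\<exists>S r \<rho>. S \<subseteq> \<Lambda> \<and> independent S \<and> card S = l \<and> span S = W \<and> r < \<rho> \<and>
     (\<forall>v\<in>S. infnorm (diag_flow \<omega> t *v v) \<le> r) \<and>
     (\<forall>v\<in>\<Lambda>. infnorm (diag_flow \<omega> t *v v) < \<rho> \<longrightarrow> v \<in> W))"

lemma gap_space_unique:
  assumes "gap_space \<omega> \<Lambda> l t W" "gap_space \<omega> \<Lambda> l t W'"
  shows "W = W'"
proof -
  have *: "W = W'"
    if S: "S \<subseteq> \<Lambda>" "independent S" "card S = l" "span S = W" "\<forall>v\<in>S. infnorm (diag_flow \<omega> t *v v) \<le> r"
      and S': "independent S'" "card S' = l" "span S' = W'"
        "\<forall>v\<in>\<Lambda>. infnorm (diag_flow \<omega> t *v v) < \<rho> \<longrightarrow> v \<in> W'"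
      and "r < \<rho>" for S r W S' \<rho> W'
  proof -
    have "S \<subseteq> W'" using S S' \<open>r < \<rho>\<close> by force
    then have "W \<subseteq> W'"
      using S(4) S'(3) span_minimal subspace_span by metis
    moreover have "dim W = l" "dim W' = l"
      using S S' by (auto simp: dim_eq_card_independent)
    ultimately show ?thesis
      using S(4) S'(3) by (intro subspace_dim_equal) auto
  qed
  obtain S r \<rho> where S: "S \<subseteq> \<Lambda>" "independent S" "card S = l" "span S = W" "r < \<rho>"
     "\<forall>v\<in>S. infnorm (diag_flow \<omega> t *v v) \<le> r" "\<forall>v\<in>\<Lambda>. infnorm (diag_flow \<omega> t *v v) < \<rho> \<longrightarrow> v \<in> W"
    using assms(1) unfolding gap_space_def by auto
  obtain S' r' \<rho>' where S': "S' \<subseteq> \<Lambda>" "independent S'" "card S' = l" "span S' = W'" "r' < \<rho>'"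
     "\<forall>v\<in>S'. infnorm (diag_flow \<omega> t *v v) \<le> r'" "\<forall>v\<in>\<Lambda>. infnorm (diag_flow \<omega> t *v v) < \<rho>' \<longrightarrow> v \<in> W'"
    using assms(2) unfolding gap_space_def by auto
  show ?thesis
  proof (cases "r < \<rho>'")
    case True
    then show ?thesis using S S' by (intro *[of S W r S' W' \<rho>']) auto
  next
    case False
    then show ?thesis using S S' by (intro *[of S' W' r' S W \<rho>, symmetric]) auto
  qed
qed

lemma eventually_gap_space:
  assumes \<omega>: "weight_vector \<omega>" and "gap_space \<omega> \<Lambda> l t W"
  shows "\<forall>\<^sub>F s in at t. gap_space \<omega> \<Lambda> l s W"
proof -
  obtain S r \<rho> where S: "S \<subseteq> \<Lambda>" "independent S" "card S = l" "span S = W" "r < \<rho>"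
     "\<And>v. v \<in> S \<Longrightarrow> infnorm (diag_flow \<omega> t *v v) \<le> r"
     "\<And>v. v \<in> \<Lambda> \<Longrightarrow> infnorm (diag_flow \<omega> t *v v) < \<rho> \<Longrightarrow> v \<in> W"
    using assms(2) unfolding gap_space_def by auto
  have "((\<lambda>s. \<rho> * exp (- \<bar>t - s\<bar>) - exp \<bar>s - t\<bar> * r) \<longlongrightarrow> \<rho> * exp (- \<bar>t - t\<bar>) - exp \<bar>t - t\<bar> * r) (at t)"
    by (intro tendsto_intros)
  then have "\<forall>\<^sub>F s in at t. \<rho> * exp (- \<bar>t - s\<bar>) - exp \<bar>s - t\<bar> * r > 0"
    using S(5) by (intro order_tendstoD(1)) auto
  then show ?thesis
  proof eventually_elim
    case (elim s)
    have "infnorm (diag_flow \<omega> s *v v) \<le> exp \<bar>s - t\<bar> * r" if "v \<in> S" for v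
      using infnorm_diag_flow_le[OF \<omega>, of s v t] S(6)[OF that] 
      by (meson exp_ge_zero mult_left_mono order_trans)
    moreover have "v \<in> W" if "v \<in> \<Lambda>" "infnorm (diag_flow \<omega> s *v v) < \<rho> * exp (- \<bar>t - s\<bar>)" for v
    proof -
      have "exp \<bar>t - s\<bar> * infnorm (diag_flow \<omega> s *v v) < \<rho>"
        using that(2) by (simp add: exp_minus field_simps)
      then show ?thesis
        using infnorm_diag_flow_le[OF \<omega>, of t v s] S(7)[OF that(1)] by linarith
    qed
    moreover have "exp \<bar>s - t\<bar> * r < \<rho> * exp (- \<bar>t - s\<bar>)"
      using elim by simp
    ultimately show ?case
      unfolding gap_space_def using S(1-4) by blast
  qed
qed

lemma gap_space_constant:
  assumes \<omega>: "weight_vector \<omega>" and ex: "\<And>t. t \<ge> T \<Longrightarrow> \<exists>W. gap_space \<omega> \<Lambda> l t W"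
  shows "\<exists>W. \<forall>t\<ge>T. gap_space \<omega> \<Lambda> l t W"
proof -
  define W where "W t = (THE W. gap_space \<omega> \<Lambda> l t W)" for t
  have W_eq: "W t = V" if "gap_space \<omega> \<Lambda> l t V" for t V
    unfolding W_def using that gap_space_unique by (intro the_equality) blast+
  have W: "gap_space \<omega> \<Lambda> l t (W t)" if "t \<ge> T" for t
    using ex[OF that] W_eq by metis
  have "W T = W t" if "t \<ge> T" for t
  proof (rule connected_local_const[of "{T..}"])
    show "\<forall>a\<in>{T..}. \<forall>\<^sub>F b in at a within {T..}. W a = W b"
    proof
      fix a assume "a \<in> {T..}"
      then have "\<forall>\<^sub>F b in at a. gap_space \<omega> \<Lambda> l b (W a)"
        by (intro eventually_gap_space[OF \<omega>] W) simp
      then have "\<forall>\<^sub>F b in at a. W a = W b"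
        by eventually_elim (use W_eq in auto)
      then show "\<forall>\<^sub>F b in at a within {T..}. W a = W b"
        by (rule filter_leD[OF at_le, rotated]) simp
    qed
  qed (use that in auto)
  then show ?thesis using W by metis
qed

lemma gap_space_if_succ_min_neq:
  fixes x :: "real^'n::finite^'m::finite"
  assumes l: "0 < l" "l < CARD('m + 'n)"
    and neq: "succ_min l ((\<lambda>v. diag_flow \<omega> t *v v) ` lattice_of x)
                \<noteq> succ_min (Suc l) ((\<lambda>v. diag_flow \<omega> t *v v) ` lattice_of x)"
  shows "\<exists>W. gap_space \<omega> (lattice_of x) l t W"
proof -
  let ?A = "\<lambda>v. diag_flow \<omega> t *v v" and ?B = "\<lambda>v. diag_flow \<omega> (- t) *v v"
  let ?L = "?A ` lattice_of x"
  have BA: "?B (?A v) = v" and AB: "?A (?B v) = v" for v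
    using diag_flow_inverse[of \<omega> t v] diag_flow_inverse[of \<omega> "- t" v] by simp_all
  have injA: "inj ?A" and injB: "inj ?B"
    using BA AB by (metis injI)+
  note fin = finite_diag_flow_lattice_bounded[of \<omega> t x]
  obtain S0 where S0: "S0 \<subseteq> lattice_of x" "independent S0" "card S0 = CARD('m + 'n)"
    using lattice_of_contains_basis by blast
  have ex: "\<exists>S\<subseteq>?L. independent S \<and> card S = i" if i: "i \<le> CARD('m + 'n)" for i
  proof -
    obtain S where S: "S \<subseteq> S0" "card S = i"
      using obtain_subset_with_card_n[of i S0] S0(3) i by metis
    have "independent (?A ` S)"
      using independent_mono[OF S0(2) S(1)] injA
      by (intro linear_independent_injective_image) (auto intro: inj_on_subset)
    moreover have "card (?A ` S) = i"
      using S(2) card_image[OF inj_on_subset[OF injA, of S]] by simp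
    ultimately show ?thesis using S(1) S0(1) by (intro exI[of _ "?A ` S"]) auto
  qed
  obtain S1 where S1: "S1 \<subseteq> ?L" "independent S1" "card S1 = Suc l"
    using ex[of "Suc l"] l by auto
  obtain S2 where S2: "S2 \<subseteq> ?L" "independent S2" "card S2 = l"
    using ex[of l] l by auto
  have lt: "succ_min l ?L < succ_min (Suc l) ?L"
    using succ_min_mono_Suc[OF fin l(1) S1] neq by simp
  obtain S' where S': "S' \<subseteq> ?L" "independent S'" "card S' = l" "\<And>v. v \<in> S' \<Longrightarrow> 2 * infnorm v \<le> succ_min l ?L"
    using succ_min_least(1)[OF fin l(1) S2] by blast
  define S where "S = ?B ` S'"
  have AS: "?A ` S = S'"
    by (simp add: S_def image_image AB)
  have S: "S \<subseteq> lattice_of x"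
    using S'(1) by (auto simp: S_def BA)
  have indS: "independent S"
    unfolding S_def using S'(2) injB
    by (intro linear_independent_injective_image) (auto intro: inj_on_subset)
  have cardS: "card S = l"
    unfolding S_def using S'(3) card_image[OF inj_on_subset[OF injB, of S']] by simp
  have "v \<in> span S" if v: "v \<in> lattice_of x" "infnorm (?A v) < succ_min (Suc l) ?L / 2" for v
  proof (rule ccontr)
    assume nv: "v \<notin> span S"
    have ind: "independent (insert v S)"
      using nv indS by (simp add: independent_insert span_base)
    have "independent (?A ` insert v S)"
      using ind injA by (intro linear_independent_injective_image) (auto intro: inj_on_subset)
    moreover have "card (?A ` insert v S) = Suc l"
    proof -
      have "finite S" using indS by (rule independent_imp_finite)
      then show ?thesis
        using cardS nv span_base[of v S] card_image[OF inj_on_subset[OF injA, of "insert v S"]]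
        by (simp add: card_insert_if) blast
    qed
    moreover have "?A ` insert v S \<subseteq> ?L"
      using v(1) S by auto
    moreover have "2 * infnorm w \<le> max (succ_min l ?L) (2 * infnorm (?A v))" if "w \<in> ?A ` insert v S" for w
      using that S'(4) AS by fastforce
    ultimately have "succ_min (Suc l) ?L \<le> max (succ_min l ?L) (2 * infnorm (?A v))"
      by (intro succ_min_least(2)[OF fin, of "Suc l" "?A ` insert v S"]) auto
    then show False using lt v(2) by auto
  qed
  moreover have "infnorm (?A v) \<le> succ_min l ?L / 2" if "v \<in> S" for v
    using S'(4)[of "?A v"] AS that by auto
  moreover have "succ_min l ?L / 2 < succ_min (Suc l) ?L / 2"
    using lt by simp
  ultimately show ?thesis
    unfolding gap_space_def using S indS cardS by blast
qed

section \<open>The determinant bound\<close>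

lemma abs_det_le_fact_mult_prod:
  fixes A :: "real^'d::finite^'d"
  assumes "\<And>i j. \<bar>A $ i $ j\<bar> \<le> b i"
  shows "\<bar>det A\<bar> \<le> fact CARD('d) * (\<Prod>i\<in>UNIV. b i)"
proof -
  have "\<bar>det A\<bar> \<le> (\<Sum>p | p permutes UNIV. \<bar>of_int (sign p) * (\<Prod>i\<in>UNIV. A $ i $ p i)\<bar>)"
    unfolding det_def by (rule sum_abs)
  also have "\<dots> \<le> (\<Sum>p | p permutes (UNIV::'d set). \<Prod>i\<in>UNIV. b i)"
    using assms by (intro sum_mono) (auto simp: abs_mult sign_def abs_prod intro!: prod_mono)
  also have "\<dots> = fact CARD('d) * (\<Prod>i\<in>UNIV. b i)"
    by (simp add: card_permutations)
  finally show ?thesis .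
qed

lemma row_mult_transpose:
  fixes A M :: "real^'d::finite^'d"
  shows "(A ** transpose M) $ i = M *v A $ i"
  by (simp add: vec_eq_iff matrix_matrix_mult_def matrix_vector_mult_def transpose_def mult.commute)

lemma det_map_rows:
  fixes A M :: "real^'d::finite^'d"
  shows "det (\<chi> i. M *v A $ i) = det A * det M"
proof -
  have "(\<chi> i. M *v A $ i) = A ** transpose M"
    by (simp add: vec_eq_iff[of "\<chi> i. M *v A $ i"] row_mult_transpose)
  then show ?thesis by (simp add: det_mul)
qed

lemma det_nonzero_if_rows_span:
  fixes A :: "real^'d::finite^'d"
  assumes "span (range (($) A)) = UNIV"
  shows "det A \<noteq> 0"
proof -
  have "x = 0" if "A *v x = 0" for x
  proof -
    have "orthogonal x (A $ i)" for i
      using that by (simp add: vec_eq_iff matrix_vector_mul_component orthogonal_def inner_commute)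
    then have "orthogonal x x"
      by (intro orthogonal_to_span[of x "range (($) A)"]) (auto simp: assms)
    then show ?thesis by (simp add: orthogonal_self)
  qed
  then show ?thesis
    by (simp add: invertible_det_nz[symmetric] invertible_left_inverse matrix_left_invertible_ker)
qed

lemma det_Ints:
  fixes A :: "real^'d::finite^'d"
  assumes "\<And>i j. A $ i $ j \<in> \<int>"
  shows "det A \<in> \<int>"
  unfolding det_def using assms by (intro Ints_sum Ints_mult Ints_prod) auto

lemma det_lattice_rows:
  fixes x :: "real^'n::finite^'m::finite"
  assumes "\<And>i. A $ i \<in> lattice_of x"
  obtains k :: int where "det A = of_int k * det (unip x)"
proof -
  have "\<forall>i. \<exists>z. A $ i = unip x *v z \<and> (\<forall>j. z $ j \<in> \<int>)"
    using assms unfolding lattice_of_def by auto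
  then obtain Z where Z: "\<And>i. A $ i = unip x *v Z i" "\<And>i j. Z i $ j \<in> \<int>"
    by metis
  have "A = (\<chi> i. unip x *v (\<chi> i. Z i) $ i)"
    using Z(1) by (simp add: vec_eq_iff)
  then have "det A = det (\<chi> i. Z i) * det (unip x)"
    using det_map_rows[of "unip x" "\<chi> i. Z i"] by simp
  moreover have "det (\<chi> i. Z i) \<in> \<int>"
    using Z(2) by (intro det_Ints) simp
  ultimately show ?thesis
    using that by (metis Ints_cases)
qed

lemma extend_basis_coordinates:
  fixes W :: "(real^(1 + 'n::finite)) set"
  assumes "subspace W" "w \<in> W" "w $ Inl 1 \<noteq> 0"
  obtains J :: "'n set" where "card J + dim W = CARD('n) + 1"
    "span (W \<union> (\<lambda>j. axis (Inr j) 1) ` J) = UNIV"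
proof -
  obtain B where B: "independent B" "span B = W" "card B = dim W"
    by (rule basis_subspace_exists[OF assms(1)])
  let ?e = "\<lambda>j. axis (Inr j) 1 :: real^(1 + 'n)"
  obtain C where C: "B \<subseteq> C" "C \<subseteq> B \<union> range ?e" "independent C" "B \<union> range ?e \<subseteq> span C"
    using maximal_independent_subset_extend[of B "B \<union> range ?e"] B(1) by auto
  have wC: "w \<in> span C"
    using assms(2) B(2) C(1) span_mono by blast
  have e: "?e j \<in> span C" for j
    using C(4) by auto
  have v0: "v = (v $ Inl 1 / w $ Inl 1) *\<^sub>R w
      + (\<Sum>j\<in>UNIV. (v $ Inr j - v $ Inl 1 / w $ Inl 1 * w $ Inr j) *\<^sub>R ?e j)" for v
    unfolding vec_eq_iff
  proof
    fix i
    show "v $ i = ((v $ Inl 1 / w $ Inl 1) *\<^sub>R w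
      + (\<Sum>j\<in>UNIV. (v $ Inr j - v $ Inl 1 / w $ Inl 1 * w $ Inr j) *\<^sub>R ?e j)) $ i"
    proof (cases i)
      case (Inl a)
      have "a = 1" by (rule num1_eq1)
      with Inl show ?thesis using assms(3) by (simp add: axis_def)
    next
      case (Inr b)
      then show ?thesis by (simp add: axis_def if_distrib cong: if_cong)
    qed
  qed
  have "span C = UNIV"
  proof -
    have "v \<in> span C" for v
      by (subst v0) (intro span_add span_scale span_sum wC e)
    then show ?thesis by auto
  qed
  then have cardC: "card C = CARD('n) + 1"
    using dim_eq_card_independent[OF C(3)] dim_span[of C] by simp
  define J where "J = {j. ?e j \<in> C - B}"
  have eJ: "?e ` J = C - B"
    using C(2) by (auto simp: J_def)
  have "card J = card (C - B)"
    unfolding eJ[symmetric] by (rule card_image[symmetric]) (auto simp: inj_on_def axis_eq_axis)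
  moreover have "card (C - B) = card C - card B" "card B \<le> card C"
    using C(1) independent_imp_finite[OF C(3)] independent_imp_finite[OF B(1)]
    by (simp_all add: card_Diff_subset card_mono)
  moreover have "C \<subseteq> W \<union> ?e ` J"
    unfolding eJ using B(2) span_base by auto
  then have "span (W \<union> ?e ` J) = UNIV"
    using \<open>span C = UNIV\<close> span_mono by blast
  ultimately show ?thesis
    using that[of J] cardC B(3) by simp
qed

text \<open>
  Any basis of \<open>W\<close> in the lattice, completed by the fixed lattice vectors \<open>g\<close>, has determinant a
  nonzero multiple of the covolume; one linear map, the same for all bases, replaces the completion
  by coordinate vectors.
\<close>
lemma det_basis_lattice_lower_bound:
  fixes x :: "real^'n::finite^'m::finite" and K :: "('m + 'n) set"
  assumes K: "card K + dim W = CARD('m + 'n)" "span (W \<union> (\<lambda>i. axis i 1) ` K) = UNIV"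
    and S0: "S0 \<subseteq> lattice_of x" "independent S0" "span S0 = W"
  obtains c where "c > 0"
    "\<And>f S. S \<subseteq> lattice_of x \<Longrightarrow> span S = W \<Longrightarrow> f ` (- K) = S \<Longrightarrow>
       \<bar>det (\<chi> i. if i \<in> K then axis i 1 else f i)\<bar> \<ge> c"
proof -
  obtain U where U: "U \<subseteq> lattice_of x" "independent U" "card U = CARD('m + 'n)"
    using lattice_of_contains_basis by blast
  have "span U = UNIV"
    using dim_eq_full[of U] by (simp add: dim_eq_card_independent U)
  obtain C where C: "S0 \<subseteq> C" "C \<subseteq> S0 \<union> U" "independent C" "S0 \<union> U \<subseteq> span C"
    using maximal_independent_subset_extend[of S0 "S0 \<union> U"] S0(2) by auto
  have "span C = UNIV"
    using C(4) \<open>span U = UNIV\<close> span_mono[of U "span C"] by (auto simp: span_span)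
  then have cardC: "card C = CARD('m + 'n)"
    using dim_eq_card_independent[OF C(3)] dim_span[of C] by simp
  have "card S0 = dim W"
    using S0(2,3) by (metis dim_span_eq_card_independent)
  then have "card (C - S0) = card K"
    using K(1) C(1) cardC independent_imp_finite[OF C(3)] independent_imp_finite[OF S0(2)]
    by (simp add: card_Diff_subset)
  then obtain g where g: "bij_betw g K (C - S0)"
    using independent_imp_finite[OF C(3)] by (metis finite finite_Diff finite_same_card_bij)
  have gC: "g i \<in> C" "g i \<notin> S0" "g i \<in> lattice_of x" if "i \<in> K" for i
    using bij_betwE[OF g] that C(2) U(1) by auto
  obtain T :: "real^('m + 'n) \<Rightarrow> real^('m + 'n)" where T: "linear T"
    "\<And>v. v \<in> C \<Longrightarrow> T v = (if v \<in> S0 then v else axis (inv_into K g v) 1)"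
    using linear_independent_extend[OF C(3), of "\<lambda>v. if v \<in> S0 then v else axis (inv_into K g v) 1"]
    by auto
  have Tg: "T (g i) = axis i 1" if "i \<in> K" for i
    using T(2)[of "g i"] gC[OF that] inv_into_f_f[OF bij_betw_imp_inj_on[OF g] that] by simp
  have TW: "T v = v" if "v \<in> W" for v
  proof (rule linear_eq_on[OF T(1) linear_ident])
    show "v \<in> span S0" using that S0(3) by simp
    show "T b = b" if "b \<in> S0" for b
      using T(2)[of b] C(1) that by auto
  qed
  have key: "\<exists>k. det (\<chi> i. if i \<in> K then axis i 1 else f i) = of_int k * det (unip x) * det (matrix T)"
    "det (\<chi> i. if i \<in> K then axis i 1 else f i) \<noteq> 0"
    if S: "S \<subseteq> lattice_of x" "span S = W" "f ` (- K) = S" for f S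
  proof -
    let ?A = "\<chi> i. if i \<in> K then axis i 1 else f i"
    let ?Q = "\<chi> i. if i \<in> K then g i else f i"
    have fW: "f i \<in> W" "f i \<in> lattice_of x" if "i \<notin> K" for i
    proof -
      have "f i \<in> S" using S(3) that by blast
      then show "f i \<in> W" "f i \<in> lattice_of x"
        using S(1,2) span_base[of "f i" S] by auto
    qed
    have "?A $ i = matrix T *v ?Q $ i" for i
      using Tg TW fW by (simp add: fun_cong[OF matrix_vector_mul(2)[OF T(1)]])
    then have "?A = (\<chi> i. matrix T *v ?Q $ i)"
      by (simp add: vec_eq_iff)
    then have "det ?A = det ?Q * det (matrix T)"
      using det_map_rows[of "matrix T" ?Q] by simp
    moreover have "?Q $ i \<in> lattice_of x" for i
      using gC(3)[of i] fW(2)[of i] by simp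
    then obtain k where "det ?Q = of_int k * det (unip x)"
      by (rule det_lattice_rows)
    ultimately show "\<exists>k. det ?A = of_int k * det (unip x) * det (matrix T)"
      by auto
    show "det ?A \<noteq> 0"
    proof (rule det_nonzero_if_rows_span)
      have "S \<union> (\<lambda>i. axis i 1) ` K \<subseteq> range (($) ?A)"
      proof -
        have "f i \<in> range (($) ?A)" if "i \<notin> K" for i
          using that by (intro image_eqI[of _ _ i]) auto
        moreover have "axis i 1 \<in> range (($) ?A)" if "i \<in> K" for i
          using that by (intro image_eqI[of _ _ i]) auto
        ultimately show ?thesis using S(3) by blast
      qed
      then have "span (S \<union> (\<lambda>i. axis i 1) ` K) \<subseteq> span (range (($) ?A))"
        by (rule span_mono)
      moreover have "span (W \<union> (\<lambda>i. axis i 1) ` K) \<subseteq> span (S \<union> (\<lambda>i. axis i 1) ` K)"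
      proof (intro span_minimal subspace_span)
        show "W \<union> (\<lambda>i. axis i 1) ` K \<subseteq> span (S \<union> (\<lambda>i. axis i 1) ` K)"
          unfolding S(2)[symmetric] using span_mono[of S "S \<union> (\<lambda>i. axis i 1) ` K"]
          by (auto intro: span_base)
      qed
      ultimately show "span (range (($) ?A)) = UNIV"
        using K(2) by blast
    qed
  qed
  define c where "c = \<bar>det (unip x) * det (matrix T)\<bar>"
  have "card (- K) = card S0"
    using K(1) \<open>card S0 = dim W\<close> by (simp add: Compl_eq_Diff_UNIV card_Diff_subset)
  then obtain f0 where "bij_betw f0 (- K) S0"
    using independent_imp_finite[OF S0(2)] by (metis finite finite_same_card_bij)
  then have "f0 ` (- K) = S0"
    by (rule bij_betw_imp_surj_on)
  show ?thesis
  proof (rule that)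
    fix f S assume S: "S \<subseteq> lattice_of x" "span S = W" "f ` (- K) = S"
    obtain k where k: "det (\<chi> i. if i \<in> K then axis i 1 else f i) = of_int k * det (unip x) * det (matrix T)"
      using key(1)[OF S] by blast
    have "k \<noteq> 0"
      using key(2)[OF S] unfolding k by auto
    then have "c * 1 \<le> c * \<bar>of_int k\<bar>"
      by (intro mult_left_mono) (auto simp: c_def)
    then show "c \<le> \<bar>det (\<chi> i. if i \<in> K then axis i 1 else f i)\<bar>"
      unfolding k by (simp add: c_def abs_mult mult_ac)
  next
    show "c > 0"
      using key[OF S0(1,3) \<open>f0 ` (- K) = S0\<close>] by (auto simp: c_def)
  qed
qed

lemma basis_radius_lower_bound:
  fixes x :: "real^'n::{finite,linorder}^1" and \<omega> :: "real^(1 + 'n::{finite,linorder})"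
  assumes \<omega>: "weight_vector \<omega>"
    and J: "card J + dim W = CARD('n) + 1" "span (W \<union> (\<lambda>j. axis (Inr j) 1) ` J) = UNIV"
    and S0: "S0 \<subseteq> lattice_of x" "independent S0" "span S0 = W"
  obtains c where "c > 0"
    "\<And>S t r. S \<subseteq> lattice_of x \<Longrightarrow> independent S \<Longrightarrow> span S = W \<Longrightarrow> 0 \<le> t \<Longrightarrow>
       (\<And>v. v \<in> S \<Longrightarrow> infnorm (diag_flow \<omega> t *v v) \<le> r) \<Longrightarrow> c \<le> r ^ dim W"
proof -
  let ?K = "Inr ` J :: (1 + 'n) set"
  have cardK: "card ?K = card J"
    by (simp add: card_image)
  have K1: "card ?K + dim W = CARD(1 + 'n)"
    using J(1) cardK by simp
  have K2: "span (W \<union> (\<lambda>i. axis i 1) ` ?K) = UNIV"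
    using J(2) by (simp only: image_image)
  obtain c where c: "c > 0"
    "\<And>f S. S \<subseteq> lattice_of x \<Longrightarrow> span S = W \<Longrightarrow> f ` (- ?K) = S \<Longrightarrow>
       \<bar>det (\<chi> i. if i \<in> ?K then axis i 1 else f i)\<bar> \<ge> c"
    by (rule det_basis_lattice_lower_bound[OF K1 K2 S0]) blast
  show ?thesis
  proof (rule that)
    show "0 < c / fact CARD(1 + 'n)"
      using c(1) by simp
  next
    fix S t r
    assume S: "S \<subseteq> lattice_of x" "independent S" "span S = W" and t: "0 \<le> t"
      and r: "\<And>v. v \<in> S \<Longrightarrow> infnorm (diag_flow \<omega> t *v v) \<le> r"
    have "card S = dim W"
      using S(2,3) by (metis dim_span_eq_card_independent)
    moreover have cK: "card (- ?K) = dim W"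
      using J(1) cardK by (simp add: Compl_eq_Diff_UNIV card_Diff_subset)
    ultimately obtain f where "bij_betw f (- ?K) S"
      using independent_imp_finite[OF S(2)] by (metis finite finite_same_card_bij)
    then have f: "f ` (- ?K) = S"
      by (rule bij_betw_imp_surj_on)
    let ?A = "\<chi> i. if i \<in> ?K then axis i 1 else f i"
    let ?b = "\<lambda>i. if i \<in> ?K then 1 else r"
    have "\<bar>(diag_flow \<omega> t *v ?A $ i) $ j\<bar> \<le> ?b i" for i j
    proof (cases "i \<in> ?K")
      case True
      then obtain k where k: "i = Inr k" "k \<in> J" by auto
      have "0 \<le> \<omega> $ Inr k * t"
        using weight_vector_pos[OF \<omega>, of "Inr k"] t by simp
      then show ?thesis
        using True k by (auto simp: diag_flow_apply axis_def)
    next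
      case False
      then have "f i \<in> S" using f by blast
      then show ?thesis
        using False r[of "f i"] component_le_infnorm_cart[of "diag_flow \<omega> t *v f i" j] by simp
    qed
    then have "\<bar>det (\<chi> i. diag_flow \<omega> t *v ?A $ i)\<bar> \<le> fact CARD(1 + 'n) * prod ?b UNIV"
      by (intro abs_det_le_fact_mult_prod) simp
    also have "prod ?b UNIV = r ^ dim W"
    proof -
      have "prod ?b UNIV = (\<Prod>i\<in>- ?K. r)"
        by (subst prod.If_cases) (auto intro!: prod.cong)
      then show ?thesis using cK by simp
    qed
    finally have "\<bar>det ?A\<bar> \<le> fact CARD(1 + 'n) * r ^ dim W"
      unfolding det_map_rows det_diag_flow[OF \<omega>] by simp
    then have "c \<le> fact CARD(1 + 'n) * r ^ dim W"
      using c(2)[OF S(1,3) f] by linarith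
    then show "c / fact CARD(1 + 'n) \<le> r ^ dim W"
      by (simp add: field_simps del: card_sum)
  qed
qed

lemma diag_flow_contracts:
  fixes \<omega> :: "real^(1 + 'n::{finite,linorder})"
  assumes "e $ Inl 1 = 0" "\<And>j. \<alpha> \<le> \<omega> $ Inr j" "0 \<le> t"
  shows "infnorm (diag_flow \<omega> t *v e) \<le> exp (- \<alpha> * t) * infnorm e"
  unfolding infnorm_le_iff_cart
proof
  fix i
  show "\<bar>(diag_flow \<omega> t *v e) $ i\<bar> \<le> exp (- \<alpha> * t) * infnorm e"
  proof (cases i)
    case (Inl a)
    have "a = 1" by (rule num1_eq1)
    with Inl assms(1) show ?thesis by (simp add: diag_flow_apply infnorm_pos_le)
  next
    case (Inr j)
    have "exp (- (\<omega> $ i) * t) \<le> exp (- \<alpha> * t)"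
      using assms(2)[of j] assms(3) Inr by (simp add: mult_right_mono)
    then show ?thesis
      using Inr component_le_infnorm_cart[of e i] 
      by (auto simp: diag_flow_apply abs_mult intro!: mult_mono)
  qed
qed

section \<open>Dirichlet approximation and connectedness\<close>

lemma lattice_point_near_subspace:
  fixes x :: "real^'n::{finite,linorder}^1" and \<omega> :: "real^(1 + 'n::{finite,linorder})"
  assumes J: "span (W \<union> (\<lambda>j. axis (Inr j) 1) ` J) = UNIV"
    and W: "subspace W" "0 < dim W"
    and q: "q \<in> lattice_of x" "q \<notin> W" and \<alpha>: "\<And>j. \<alpha> \<le> \<omega> $ Inr j"
  obtains C where
    "\<And>S t r. S \<subseteq> lattice_of x \<Longrightarrow> independent S \<Longrightarrow> span S = W \<Longrightarrow> 0 \<le> t \<Longrightarrow>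
       (\<And>v. v \<in> S \<Longrightarrow> infnorm (diag_flow \<omega> t *v v) \<le> r) \<Longrightarrow>
       \<exists>w\<in>lattice_of x. w \<notin> W \<and> infnorm (diag_flow \<omega> t *v w) \<le> r / 2 + C * exp (- \<alpha> * t)"
proof -
  have "q \<in> span (W \<union> (\<lambda>j. axis (Inr j) 1) ` J)"
    using J by simp
  then obtain w0 e where we: "w0 \<in> span W" "e \<in> span ((\<lambda>j. axis (Inr j) 1) ` J)" "q = w0 + e"
    unfolding span_Un by auto
  have e0: "e $ Inl 1 = 0"
    using we(2) by (induction rule: span_induct) (auto simp: axis_def subspace_def)
  define l where "l = dim W"
  define N where "N = 2 * l"
  have "N > 0" using W(2) by (simp add: N_def l_def)
  show ?thesis
  proof (rule that[of "real (N ^ l) * infnorm e"])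
    fix S t r
    assume S: "S \<subseteq> lattice_of x" "independent S" "span S = W" and t: "0 \<le> t"
      and r: "\<And>v. v \<in> S \<Longrightarrow> infnorm (diag_flow \<omega> t *v v) \<le> r"
    have finS: "finite S" using S(2) by (rule independent_imp_finite)
    have cS: "card S = l"
      using S(2,3) unfolding l_def by (metis dim_span_eq_card_independent)
    obtain f where f: "bij_betw f {..<l} S"
      using ex_bij_betw_nat_finite[OF finS] cS by (auto simp: atLeast0LessThan)
    have fS: "f i \<in> S" if "i < l" for i
      using bij_betwE[OF f] that by auto
    have "w0 \<in> span S"
      using we(1) S(3) span_span by metis
    then obtain \<gamma> where "w0 = (\<Sum>v\<in>S. \<gamma> v *\<^sub>R v)"
      using span_finite[OF finS] by auto
    then have w0: "w0 = (\<Sum>i<l. \<gamma> (f i) *\<^sub>R f i)"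
      using sum.reindex_bij_betw[OF f, of "\<lambda>v. \<gamma> v *\<^sub>R v"] by simp
    obtain m p where m: "0 < m" "m \<le> int (N ^ l)"
      and p: "\<And>i. i < l \<Longrightarrow> \<bar>of_int m * \<gamma> (f i) - of_int (p i)\<bar> < 1 / N"
      using Dirichlet_approx_simult[OF \<open>N > 0\<close>, of l "\<lambda>i. \<gamma> (f i)"] by blast
    define s where "s = (\<Sum>i<l. of_int (p i) *\<^sub>R f i)"
    define w where "w = of_int m *\<^sub>R q - s"
    have "s \<in> lattice_of x"
      unfolding s_def using fS S(1) by (intro lattice_of_sum lattice_of_scale) auto
    then have "w \<in> lattice_of x"
      unfolding w_def by (intro lattice_of_diff lattice_of_scale q(1))
    have "s \<in> W"
      unfolding s_def S(3)[symmetric] using fS by (intro span_sum span_scale span_base) auto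
    have "w \<notin> W"
    proof
      assume "w \<in> W"
      then have "(1 / of_int m) *\<^sub>R (w + s) \<in> W"
        using W(1) \<open>s \<in> W\<close> by (intro subspace_scale subspace_add)
      then show False using q(2) m(1) by (simp add: w_def)
    qed
    have w_eq: "w = (\<Sum>i<l. (of_int m * \<gamma> (f i) - of_int (p i)) *\<^sub>R f i) + of_int m *\<^sub>R e"
      unfolding w_def s_def we(3) w0
      by (simp add: scaleR_right_distrib scaleR_sum_right scaleR_diff_left sum_subtractf)
    let ?a = "\<lambda>v. diag_flow \<omega> t *v v"
    have a_eq: "?a w = (\<Sum>i<l. (of_int m * \<gamma> (f i) - of_int (p i)) *\<^sub>R ?a (f i)) + of_int m *\<^sub>R ?a e"
      unfolding w_eq
      by (simp add: matrix_vector_right_distrib linear_sum[OF matrix_vector_mul_linear] matrix_vector_mult_scaleR)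
    have le: "infnorm ((of_int m * \<gamma> (f i) - of_int (p i)) *\<^sub>R ?a (f i)) \<le> 1 / N * r" if "i < l" for i
      unfolding infnorm_mul using p[OF that] r[OF fS[OF that]]
      by (intro mult_mono) (auto simp: infnorm_pos_le)
    have "infnorm (\<Sum>i<l. (of_int m * \<gamma> (f i) - of_int (p i)) *\<^sub>R ?a (f i)) \<le> (\<Sum>i<l. 1 / N * r)"
      using le by (intro order_trans[OF infnorm_sum_le] sum_mono) auto
    also have "\<dots> = r / 2"
      using \<open>N > 0\<close> by (simp add: N_def)
    finally have 1: "infnorm (\<Sum>i<l. (of_int m * \<gamma> (f i) - of_int (p i)) *\<^sub>R ?a (f i)) \<le> r / 2" .
    have "infnorm (of_int m *\<^sub>R ?a e) = of_int m * infnorm (?a e)"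
      using m(1) by (simp add: infnorm_mul)
    also have "\<dots> \<le> real (N ^ l) * (exp (- \<alpha> * t) * infnorm e)"
    proof (rule mult_mono)
      show "of_int m \<le> real (N ^ l)"
        using m(2) by (metis of_int_le_iff of_int_of_nat_eq)
    qed (use diag_flow_contracts[OF e0 \<alpha> t] in \<open>auto simp: infnorm_pos_le\<close>)
    finally have "infnorm (?a w) \<le> r / 2 + real (N ^ l) * infnorm e * exp (- \<alpha> * t)"
      unfolding a_eq using 1 infnorm_triangle[of "\<Sum>i<l. (of_int m * \<gamma> (f i) - of_int (p i)) *\<^sub>R ?a (f i)"
          "of_int m *\<^sub>R ?a e"] by (simp add: mult_ac)
    with \<open>w \<in> lattice_of x\<close> \<open>w \<notin> W\<close>
    show "\<exists>w\<in>lattice_of x. w \<notin> W \<and> infnorm (?a w) \<le> r / 2 + real (N ^ l) * infnorm e * exp (- \<alpha> * t)"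
      by blast
  qed
qed

lemma lattice_of_not_subset:
  fixes x :: "real^'n::finite^'m::finite"
  assumes "dim W < CARD('m + 'n)"
  shows "\<exists>q\<in>lattice_of x. q \<notin> W"
proof (rule ccontr)
  assume *: "\<not> ?thesis"
  obtain U where U: "U \<subseteq> lattice_of x" "independent U" "card U = CARD('m + 'n)"
    using lattice_of_contains_basis by blast
  have "U \<subseteq> W"
    using U(1) * by blast
  then have "card U \<le> dim W"
    using U(2) by (rule independent_card_le_dim)
  then show False using assms U(3) by simp
qed

lemma lattice_of_not_in_hyperplane:
  fixes y :: "real^'n::{finite,linorder}^1"
  assumes y: "one_and_entries_independent y S"
    and B: "B \<subseteq> lattice_of y" "independent B" "card B + card S > CARD('n)"
  shows "\<exists>w\<in>B. w $ Inl 1 \<noteq> 0"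
proof (rule ccontr)
  assume *: "\<not> ?thesis"
  let ?u = "(*v) (unip (- y))"
  have inj: "inj ?u"
    using unip_inverse[of "- y"] by (metis injI)
  have int: "\<exists>z. w = unip y *v z \<and> ?u w = z \<and> (\<forall>i. z $ i \<in> \<int>)" if w: "w \<in> B" for w
  proof -
    obtain z where "w = unip y *v z" "\<forall>i. z $ i \<in> \<int>"
      using w B(1) unfolding lattice_of_def by blast
    then show ?thesis by (auto simp: unip_inverse)
  qed
  have "card (?u ` B) + card S \<le> CARD('n)"
  proof (rule card_rational_kernel_le[OF y])
    show "independent (?u ` B)"
      using B(2) inj by (intro linear_independent_injective_image) (auto intro: inj_on_subset)
    show "v $ i \<in> \<rat>" if "v \<in> ?u ` B" for v i
      using that int Ints_subset_Rats by blast
    show "xtilde y *v v = 0" if v: "v \<in> ?u ` B" for v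
    proof -
      obtain w where w: "w \<in> B" "v = ?u w" using v by blast
      then have "w = unip y *v v" using int[OF w(1)] by auto
      then have "(xtilde y *v v) $ 1 = w $ Inl 1"
        by (simp add: xtilde_apply unip_apply_Inl)
      then show ?thesis
        using * w(1) by (simp add: vec_eq_iff num1_eq1)
    qed
  qed
  then show False
    using B(3) card_image[OF inj_on_subset[OF inj, of B]] by simp
qed

lemma connected_at_lattice_of:
  fixes \<omega> :: "real^(1 + 'n::{finite,linorder})" and y :: "real^'n::{finite,linorder}^1"
  assumes \<omega>: "weight_vector \<omega>" and y: "one_and_entries_independent y A"
    and l: "0 < l" "l < CARD('n) + 1" "CARD('n) < l + card A"
  shows "connected_at \<omega> (lattice_of y) l"
  unfolding connected_at_def
proof
  let ?\<Lambda> = "lattice_of y"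
  assume "bdd_above {t. 0 \<le> t \<and> log_min \<omega> ?\<Lambda> l t = log_min \<omega> ?\<Lambda> (Suc l) t}"
  then obtain M where M: "\<And>t. 0 \<le> t \<Longrightarrow> log_min \<omega> ?\<Lambda> l t = log_min \<omega> ?\<Lambda> (Suc l) t \<Longrightarrow> t \<le> M"
    by (auto simp: bdd_above_def)
  define T where "T = max 0 (M + 1)"
  have "T \<ge> 0" by (simp add: T_def)
  have "\<exists>W. gap_space \<omega> ?\<Lambda> l t W" if "t \<ge> T" for t
  proof (rule gap_space_if_succ_min_neq)
    show "succ_min l ((\<lambda>v. diag_flow \<omega> t *v v) ` ?\<Lambda>) \<noteq> succ_min (Suc l) ((\<lambda>v. diag_flow \<omega> t *v v) ` ?\<Lambda>)"
      using M[of t] that unfolding log_min_def T_def by auto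
  qed (use l in auto)
  then obtain W where W: "\<And>t. t \<ge> T \<Longrightarrow> gap_space \<omega> ?\<Lambda> l t W"
    using gap_space_constant[OF \<omega>] by metis
  obtain S0 where S0: "S0 \<subseteq> ?\<Lambda>" "independent S0" "card S0 = l" "span S0 = W"
    using W[of T] unfolding gap_space_def by auto
  have subW: "subspace W" and dimW: "dim W = l"
    using S0 by (auto simp: dim_eq_card_independent)
  obtain w where "w \<in> S0" "w $ Inl 1 \<noteq> 0"
    using lattice_of_not_in_hyperplane[OF y S0(1,2)] S0(3) l(3) by auto
  moreover from this have "w \<in> W"
    using S0(4) span_base by auto
  ultimately obtain J :: "'n set" where J: "card J + dim W = CARD('n) + 1"
    "span (W \<union> (\<lambda>j. axis (Inr j) 1) ` J) = UNIV"
    by (metis extend_basis_coordinates[OF subW])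
  obtain q where q: "q \<in> ?\<Lambda>" "q \<notin> W"
    using lattice_of_not_subset[of W y] dimW l(2) by auto
  obtain c where c: "c > 0"
    "\<And>S t r. S \<subseteq> ?\<Lambda> \<Longrightarrow> independent S \<Longrightarrow> span S = W \<Longrightarrow> 0 \<le> t \<Longrightarrow>
       (\<And>v. v \<in> S \<Longrightarrow> infnorm (diag_flow \<omega> t *v v) \<le> r) \<Longrightarrow> c \<le> r ^ dim W"
    by (rule basis_radius_lower_bound[OF \<omega> J S0(1,2,4)]) blast
  define \<alpha> where "\<alpha> = Min (range (\<lambda>j. \<omega> $ Inr j))"
  have "\<alpha> > 0" and \<alpha>: "\<alpha> \<le> \<omega> $ Inr j" for j
    unfolding \<alpha>_def using weight_vector_pos[OF \<omega>] by (simp_all add: Min_gr_iff)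
  obtain C where C:
    "\<And>S t r. S \<subseteq> ?\<Lambda> \<Longrightarrow> independent S \<Longrightarrow> span S = W \<Longrightarrow> 0 \<le> t \<Longrightarrow>
       (\<And>v. v \<in> S \<Longrightarrow> infnorm (diag_flow \<omega> t *v v) \<le> r) \<Longrightarrow>
       \<exists>w\<in>?\<Lambda>. w \<notin> W \<and> infnorm (diag_flow \<omega> t *v w) \<le> r / 2 + C * exp (- \<alpha> * t)"
    by (rule lattice_point_near_subspace[OF J(2) subW _ q \<alpha>]) (use dimW l(1) in \<open>blast | simp\<close>)+
  have le: "c \<le> (2 * C * exp (- \<alpha> * t)) ^ l" if "t \<ge> T" for t
  proof -
    have "t \<ge> 0" using that \<open>T \<ge> 0\<close> by simp
    obtain S r \<rho> where S: "S \<subseteq> ?\<Lambda>" "independent S" "card S = l" "span S = W" "r < \<rho>"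
      "\<And>v. v \<in> S \<Longrightarrow> infnorm (diag_flow \<omega> t *v v) \<le> r"
      "\<And>v. v \<in> ?\<Lambda> \<Longrightarrow> infnorm (diag_flow \<omega> t *v v) < \<rho> \<Longrightarrow> v \<in> W"
      using W[OF \<open>t \<ge> T\<close>] unfolding gap_space_def by auto
    obtain v where "v \<in> S"
      using S(3) l(1) by fastforce
    then have "0 \<le> r"
      using S(6) infnorm_pos_le order_trans by blast
    obtain w where "w \<in> ?\<Lambda>" "w \<notin> W" "infnorm (diag_flow \<omega> t *v w) \<le> r / 2 + C * exp (- \<alpha> * t)"
      using C[OF S(1,2,4) \<open>t \<ge> 0\<close> S(6)] by blast
    then have "r \<le> 2 * C * exp (- \<alpha> * t)"
      using S(5) S(7)[of w] by linarith
    then have "r ^ l \<le> (2 * C * exp (- \<alpha> * t)) ^ l"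
      using \<open>0 \<le> r\<close> by (rule power_mono)
    then show ?thesis
      using c(2)[OF S(1,2,4) \<open>t \<ge> 0\<close> S(6)] dimW by simp
  qed
  have "((\<lambda>t. exp (- \<alpha> * t)) \<longlongrightarrow> 0) at_top"
    using \<open>\<alpha> > 0\<close>
    by (intro filterlim_compose[OF exp_at_bot] filterlim_tendsto_neg_mult_at_bot[OF tendsto_const _ filterlim_ident]) simp
  then have "((\<lambda>t. (2 * C * exp (- \<alpha> * t)) ^ l) \<longlongrightarrow> (2 * C * 0) ^ l) at_top"
    by (intro tendsto_intros)
  then have "\<forall>\<^sub>F t in at_top. (2 * C * exp (- \<alpha> * t)) ^ l < c"
    by (rule order_tendstoD(2)) (use c(1) l(1) in \<open>simp add: power_0_left\<close>)
  then have "\<forall>\<^sub>F t in at_top. (2 * C * exp (- \<alpha> * t)) ^ l < c \<and> t \<ge> T"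
    using eventually_ge_at_top by (rule eventually_conj)
  then obtain t where "(2 * C * exp (- \<alpha> * t)) ^ l < c" "t \<ge> T"
    using eventually_happens'[OF trivial_limit_at_top_linorder] by blast
  then show False
    using le[of t] by simp
qed

lemma one_and_entries_independent_subset:
  assumes "one_and_entries_independent y S" "S' \<subseteq> S"
  shows "one_and_entries_independent y S'"
proof -
  interpret Q: vector_space "\<lambda>(q::rat) (r::real). of_rat q * r"
    by unfold_locales (auto simp: algebra_simps of_rat_add of_rat_mult)
  have sub: "insert None (Some ` S') \<subseteq> insert None (Some ` S)"
    using assms(2) by auto
  let ?v = "case_option 1 (\<lambda>j. y $ 1 $ j)"
  have v: "inj_on ?v (insert None (Some ` S))" "Q.independent (?v ` insert None (Some ` S))"
    using assms(1) unfolding one_and_entries_independent_def rat_independent_family_def by simp_all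
  show ?thesis
    unfolding one_and_entries_independent_def rat_independent_family_def
    using inj_on_subset[OF v(1) sub] Q.independent_mono[OF v(2) image_mono[OF sub]] by (rule conjI)
qed

theorem corollary1p15:
  fixes d :: nat
    and \<omega> :: "real^(1 + 'n::{finite,linorder})"
    and y :: "real^'n::{finite,linorder}^1"
  assumes "d \<ge> 2" and "CARD('n) = d - 1"
    and "weight_vector \<omega>"
  shows "(\<forall>k\<in>{1..d-1}.
            (\<exists>S::'n set. card S = k \<and> one_and_entries_independent y S) \<longrightarrow>
              \<not> (\<exists>P. proper_rational_weakly_constraining_pencil \<omega> (d - k) P \<and> {y} \<subseteq> P) \<and>
              connected_at \<omega> (lattice_of y) (d - k)) \<and>
         (one_and_entries_independent y UNIV \<longrightarrow>
            (\<forall>k\<in>{1..d-1}. connected_at \<omega> (lattice_of y) k))"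
proof (intro conjI ballI impI)
  fix k assume k: "k \<in> {1..d-1}" and "\<exists>S::'n set. card S = k \<and> one_and_entries_independent y S"
  then obtain S :: "'n set" where S: "card S = k" "one_and_entries_independent y S"
    by blast
  show "connected_at \<omega> (lattice_of y) (d - k)"
    using k assms(1,2) S(1) by (intro connected_at_lattice_of[OF assms(3) S(2)]) auto
  show "\<not> (\<exists>P. proper_rational_weakly_constraining_pencil \<omega> (d - k) P \<and> {y} \<subseteq> P)"
  proof
    assume "\<exists>P. proper_rational_weakly_constraining_pencil \<omega> (d - k) P \<and> {y} \<subseteq> P"
    then obtain W a b where W: "subspace W" "dim W = d - k" "rational_subspace W" "b \<le> a" "y \<in> pencil \<omega> W a b"
      unfolding proper_rational_weakly_constraining_pencil_def by auto
    moreover have "CARD('n) < dim W + card S" "dim W \<le> CARD('n)"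
      using W(2) k assms(1,2) S(1) by auto
    ultimately show False
      using not_in_weakly_constraining_pencil[OF assms(3) S(2) W(1,3)] by blast
  qed
next
  fix k assume y: "one_and_entries_independent y UNIV" and k: "k \<in> {1..d-1}"
  have "d - k \<le> CARD('n)"
    using k assms(2) by auto
  then obtain S :: "'n set" where S: "card S = d - k"
    by (rule obtain_subset_with_card_n)
  show "connected_at \<omega> (lattice_of y) k"
    using k assms(1,2) S
    by (intro connected_at_lattice_of[OF assms(3) one_and_entries_independent_subset[OF y subset_UNIV, of S]]) auto
qed

end
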